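(* Let $\lambda\ge0$. Let $\psi(\varepsilon,d)=[g(d)+k]\,\psi_0^+(\varepsilon)+(1+k)\,\psi_0^-(\varepsilon)$, $\varepsilon\in\mathbb{S}^m$, $d\in[0,1]$, with the spectral splitting $$\psi_0^{\pm}(\varepsilon)=\frac{\lambda}{2}\Big\langle\sum_{i=1}^m\operatorname{Eig}(\varepsilon)_i\Big\rangle_\pm^2+\mu\sum_{i=1}^m\langle\operatorname{Eig}(\varepsilon)_i\rangle_\pm^2 .$$ Then: (P1) $\psi(\varepsilon,\cdot)\in C^2$ for all $\varepsilon\in\mathbb{S}^m$, and $\psi(\cdot,d)\in C^{1,1}$ for all $d\in[0,1]$. (P2) The gradient $\nabla\psi(\cdot,d)$ is semismooth for all $d\in[0,1]$. (P3) There is $L\ge0$ independent of $d$ with $|\nabla\psi(A,d)-\nabla\psi(B,d)|\le L|A-B|_F$ for all $A,B\in\mathbb{S}^m$. (P4) There is $\eta>0$ independent of $d$ such that $\psi(tA+(1-t)B,d)\le t\psi(A,d)+(1-t)\psi(B,d)-\frac12\eta t(1-t)|A-B|_F^2$ for all $A,B\in\mathbb{S}^m$, $t\in[0,1]$. (P5) There is $C>0$ independent of $d$ such that $\psi(\varepsilon,d)\ge C|\varepsilon|_F^2$ for all $\varepsilon\in\mathbb{S}^m$. Furthermore, $\psi(\cdot,d)$ is not $C^2$, unless $g(d)=1$.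
   Context: $\mathbb{S}^m$ is the space of real symmetric $m\times m$ matrices with Frobenius norm $|\cdot|_F$; $\operatorname{Eig}(\varepsilon)\in\mathbb{R}^m$ is the vector of eigenvalues of $\varepsilon$ in ascending order; $\langle x\rangle_+=\max\{0,x\}$, $\langle x\rangle_-=\min\{0,x\}$. $\mu>0$ is a constant. $g:[0,1]\to[0,1]$ is convex, twice continuously differentiable, monotone decreasing with $g(0)=1$, $g(1)=0$; $k>0$ is a constant. $\nabla\psi(\cdot,d)$ is the gradient with respect to the matrix argument. $C^{1,1}$ means differentiable with locally Lipschitz continuous derivative. A locally Lipschitz map $F:\mathbb{S}^m\to\mathbb{S}^m$ is semismooth if for every $A,V\in\mathbb{S}^m$ the limit $\lim_{n\to\infty}G_nV_n$ exists and is the same for all sequences $V_n\to V$, $t_n\searrow0$, $G_n\in\partial F(A+t_nV_n)$, where $\partial F$ is Clarke's generalized Jacobian. *)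

theory Defs
  imports "HOL-Analysis.Analysis" "HOL-Computational_Algebra.Polynomial"
begin

section \<open>The Euclidean space of real symmetric matrices\<close>

typedef ('n::finite) symmat = "{A :: real^'n^'n. transpose A = A}"
  morphisms mat_of Symmat
  by (rule exI[of _ 0]) (simp add: transpose_def vec_eq_iff)

setup_lifting type_definition_symmat

instantiation symmat :: (finite) real_vector
begin

lift_definition zero_symmat :: "'a symmat" is 0
  by (simp add: transpose_def vec_eq_iff)
lift_definition plus_symmat :: "'a symmat \<Rightarrow> 'a symmat \<Rightarrow> 'a symmat" is "(+)"
  by (simp add: transpose_def vec_eq_iff)
lift_definition minus_symmat :: "'a symmat \<Rightarrow> 'a symmat \<Rightarrow> 'a symmat" is "(-)"
  by (simp add: transpose_def vec_eq_iff)
lift_definition uminus_symmat :: "'a symmat \<Rightarrow> 'a symmat" is uminus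
  by (simp add: transpose_def vec_eq_iff)
lift_definition scaleR_symmat :: "real \<Rightarrow> 'a symmat \<Rightarrow> 'a symmat" is "(*\<^sub>R)"
  by (simp add: transpose_def vec_eq_iff)

instance
  by standard (transfer; simp add: algebra_simps)+

end

text \<open>
  On \<^typ>\<open>real^'n^'n\<close> the inner product is the sum of the products of corresponding entries, so
  the inner product and the norm inherited here are those of Frobenius.
\<close>

instantiation symmat :: (finite) real_inner
begin

lift_definition inner_symmat :: "'a symmat \<Rightarrow> 'a symmat \<Rightarrow> real" is inner .
lift_definition norm_symmat :: "'a symmat \<Rightarrow> real" is norm .

definition dist_symmat :: "'a symmat \<Rightarrow> 'a symmat \<Rightarrow> real"
  where "dist_symmat A B = norm (A - B)"
definition sgn_symmat :: "'a symmat \<Rightarrow> 'a symmat"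
  where "sgn_symmat A = inverse (norm A) *\<^sub>R A"
definition uniformity_symmat :: "('a symmat \<times> 'a symmat) filter"
  where "uniformity_symmat = (INF e\<in>{0<..}. principal {(A, B). dist A B < e})"
definition open_symmat :: "'a symmat set \<Rightarrow> bool"
  where "open_symmat U \<longleftrightarrow> (\<forall>A\<in>U. \<forall>\<^sub>F (A', B) in uniformity. A' = A \<longrightarrow> B \<in> U)"

instance
proof
  fix A B C :: "'a symmat" and r :: real and U :: "'a symmat set"
  show "dist A B = norm (A - B)" by (rule dist_symmat_def)
  show "sgn A = inverse (norm A) *\<^sub>R A" by (rule sgn_symmat_def)
  show "(uniformity :: ('a symmat \<times> 'a symmat) filter)
      = (INF e\<in>{0<..}. principal {(A, B). dist A B < e})"
    by (rule uniformity_symmat_def)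
  show "open U \<longleftrightarrow> (\<forall>A\<in>U. \<forall>\<^sub>F (A', B) in uniformity. A' = A \<longrightarrow> B \<in> U)"
    by (rule open_symmat_def)
  show "inner A B = inner B A" by transfer (rule inner_commute)
  show "inner (A + B) C = inner A C + inner B C" by transfer (rule inner_add_left)
  show "inner (r *\<^sub>R A) B = r * inner A B" by transfer simp
  show "0 \<le> inner A A" by transfer simp
  show "inner A A = 0 \<longleftrightarrow> A = 0" by transfer simp
  show "norm A = sqrt (inner A A)" by transfer (rule norm_eq_sqrt_inner)
qed

end

lemma norm_symmat_Frobenius:
  fixes A :: "'n::finite symmat"
  shows "norm A = sqrt (\<Sum>i\<in>UNIV. \<Sum>j\<in>UNIV. (mat_of A $ i $ j)\<^sup>2)"
  by (simp add: norm_eq_sqrt_inner inner_symmat.rep_eq inner_vec_def power2_eq_square)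

lemma symmat_orthonormal_basis_exists:
  "\<exists>B :: 'n::finite symmat set. B \<noteq> {} \<and> finite B
     \<and> (\<forall>u\<in>B. \<forall>v\<in>B. inner u v = (if u = v then 1 else 0))
     \<and> (\<forall>x. (\<forall>u\<in>B. inner x u = 0) \<longleftrightarrow> x = 0)"
proof -
  let ?S = "{A :: real^'n^'n. transpose A = A}"
  have sub: "subspace ?S"
    by (simp add: subspace_def transpose_def vec_eq_iff)
  obtain C where C: "C \<subseteq> ?S" "pairwise orthogonal C" "\<And>x. x \<in> C \<Longrightarrow> norm x = 1"
      "independent C" "card C = dim ?S" "span C = ?S"
    by (rule orthonormal_basis_subspace[OF sub]) (rule that; (assumption | blast))
  define B where "B = {A. mat_of A \<in> C}"
  have BC: "mat_of ` B = C"
  proof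
    show "C \<subseteq> mat_of ` B"
    proof
      fix M assume "M \<in> C"
      with C(1) have "mat_of (Symmat M) = M" by (auto simp: Symmat_inverse)
      with \<open>M \<in> C\<close> show "M \<in> mat_of ` B" unfolding B_def by (metis image_eqI mem_Collect_eq)
    qed
  qed (auto simp: B_def)
  have inj: "inj_on mat_of B" by (simp add: inj_on_def mat_of_inject)
  have fin: "finite B"
    using finite_imageD[OF _ inj] BC independent_imp_finite[OF C(4)] by simp
  have ne: "B \<noteq> {}"
  proof
    assume "B = {}"
    with BC have "C = {}" by simp
    with C(6) have "?S = {0}" by simp
    moreover have "(mat 1 :: real^'n^'n) \<in> ?S" by simp
    ultimately have "(mat 1 :: real^'n^'n) = 0" by blast
    then have "(mat 1 :: real^'n^'n) $ undefined $ undefined = 0" by simp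
    then show False by (simp add: mat_def)
  qed
  have orth: "inner u v = (if u = v then 1 else 0)" if "u \<in> B" "v \<in> B" for u v
  proof (cases "u = v")
    case True
    with that C(3) have "norm (mat_of u) = 1" by (auto simp: B_def)
    with True show ?thesis by (simp add: inner_symmat.rep_eq norm_eq_1)
  next
    case False
    then have "mat_of u \<noteq> mat_of v" by (simp add: mat_of_inject)
    with that C(2) False show ?thesis
      by (auto simp: B_def inner_symmat.rep_eq pairwise_def orthogonal_def)
  qed
  have zero: "(\<forall>u\<in>B. inner x u = 0) \<longleftrightarrow> x = 0" for x
  proof
    assume *: "\<forall>u\<in>B. inner x u = 0"
    have "orthogonal (mat_of x) M" if "M \<in> C" for M
      using that * BC by (auto simp: inner_symmat.rep_eq orthogonal_def)
    moreover have "mat_of x \<in> span C" using mat_of[of x] C(6) by simp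
    ultimately have "orthogonal (mat_of x) (mat_of x)"
      using orthogonal_to_span by blast
    then have "inner x x = 0" by (simp add: inner_symmat.rep_eq orthogonal_def)
    then show "x = 0" by simp
  qed simp
  show ?thesis using ne fin orth zero by blast
qed

instantiation symmat :: (finite) euclidean_space
begin

definition Basis_symmat :: "'a symmat set" where
  "Basis_symmat = (SOME B. B \<noteq> {} \<and> finite B
     \<and> (\<forall>u\<in>B. \<forall>v\<in>B. inner u v = (if u = v then 1 else 0))
     \<and> (\<forall>x. (\<forall>u\<in>B. inner x u = 0) \<longleftrightarrow> x = 0))"

instance
proof -
  let ?P = "\<lambda>B :: 'a symmat set. B \<noteq> {} \<and> finite B
     \<and> (\<forall>u\<in>B. \<forall>v\<in>B. inner u v = (if u = v then 1 else 0))
     \<and> (\<forall>x. (\<forall>u\<in>B. inner x u = 0) \<longleftrightarrow> x = 0)"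
  have B: "?P Basis"
    unfolding Basis_symmat_def by (rule someI_ex[of ?P, OF symmat_orthonormal_basis_exists])
  show "OFCLASS('a symmat, euclidean_space_class)"
  proof
    show "(Basis :: 'a symmat set) \<noteq> {}" using B by (elim conjE)
    show "finite (Basis :: 'a symmat set)" using B by (elim conjE)
  next
    fix u v :: "'a symmat"
    assume "u \<in> Basis" "v \<in> Basis"
    then show "inner u v = (if u = v then 1 else 0)" using B[THEN conjunct2, THEN conjunct2, THEN conjunct1]
      by (meson bspec)
  next
    fix x :: "'a symmat"
    show "(\<forall>u\<in>Basis. inner x u = 0) \<longleftrightarrow> x = 0" 
      by (rule spec[OF B[THEN conjunct2, THEN conjunct2, THEN conjunct2]])
  qed
qed

end

section \<open>Eigenvalues\<close>

text \<open>The characteristic polynomial $\det(x I - A)$.\<close>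

definition charpoly :: "real^'n^'n \<Rightarrow> real poly" where
  "charpoly A = det (mat [:0, 1:] - map_matrix (\<lambda>a. [:a:]) A)"

text \<open>
  Eigenvalues in ascending order, repeated according to multiplicity. As all roots of the
  characteristic polynomial of a real symmetric matrix are real, the list has length
  \<^term>\<open>CARD('n)\<close>; it stands for a vector in $R^m$ and its indices start at 0.
\<close>

definition Eig :: "'n::finite symmat \<Rightarrow> real list" where
  "Eig A = sorted_list_of_multiset (proots (charpoly (mat_of A)))"

section \<open>Smoothness notions\<close>

text \<open>
  The set \<open>S\<close> is meant to be the whole space or a compact interval of positive length (with
  one-sided derivatives at the end points), where derivatives within \<open>S\<close> are unique.
\<close>

definition C2_on :: "'a::real_normed_vector set \<Rightarrow> ('a \<Rightarrow> 'b::real_normed_vector) \<Rightarrow> bool" where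
  "C2_on S f \<longleftrightarrow>
     (\<exists>(f' :: 'a \<Rightarrow> 'a \<Rightarrow>\<^sub>L 'b) (f'' :: 'a \<Rightarrow> 'a \<Rightarrow>\<^sub>L ('a \<Rightarrow>\<^sub>L 'b)).
        (\<forall>x\<in>S. (f has_derivative blinfun_apply (f' x)) (at x within S)
             \<and> (f' has_derivative blinfun_apply (f'' x)) (at x within S))
        \<and> continuous_on S f'')"

definition locally_lipschitz :: "('a::metric_space \<Rightarrow> 'b::metric_space) \<Rightarrow> bool" where
  "locally_lipschitz F \<longleftrightarrow> (\<forall>x. \<exists>u>0. \<exists>L. L-lipschitz_on (cball x u) F)"

definition C11 :: "('a::real_normed_vector \<Rightarrow> 'b::real_normed_vector) \<Rightarrow> bool" where
  "C11 f \<longleftrightarrow>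
     (\<exists>f' :: 'a \<Rightarrow> 'a \<Rightarrow>\<^sub>L 'b.
        (\<forall>x. (f has_derivative blinfun_apply (f' x)) (at x)) \<and> locally_lipschitz f')"

definition gradient :: "('a::real_inner \<Rightarrow> real) \<Rightarrow> 'a \<Rightarrow> 'a" where
  "gradient f x = (THE D. GDERIV f x :> D)"

text \<open>
  Clarke's generalized Jacobian: the convex hull of all limits of derivatives at points of
  differentiability converging to \<open>x\<close>.
\<close>

definition clarke_jacobian ::
  "('a::euclidean_space \<Rightarrow> 'b::euclidean_space) \<Rightarrow> 'a \<Rightarrow> ('a \<Rightarrow>\<^sub>L 'b) set" where
  "clarke_jacobian F x = convex hull
     {G. \<exists>(X :: nat \<Rightarrow> 'a) (D :: nat \<Rightarrow> 'a \<Rightarrow>\<^sub>L 'b).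
           X \<longlonglongrightarrow> x
         \<and> (\<forall>n. (F has_derivative blinfun_apply (D n)) (at (X n)))
         \<and> D \<longlonglongrightarrow> G}"

definition semismooth :: "('a::euclidean_space \<Rightarrow> 'b::euclidean_space) \<Rightarrow> bool" where
  "semismooth F \<longleftrightarrow> locally_lipschitz F \<and>
     (\<forall>A V. \<exists>l. \<forall>(W :: nat \<Rightarrow> 'a) (t :: nat \<Rightarrow> real) (G :: nat \<Rightarrow> 'a \<Rightarrow>\<^sub>L 'b).
        W \<longlonglongrightarrow> V \<and> (\<forall>n. t n > 0) \<and> t \<longlonglongrightarrow> 0
          \<and> (\<forall>n. G n \<in> clarke_jacobian F (A + t n *\<^sub>R W n))
        \<longrightarrow> (\<lambda>n. blinfun_apply (G n) (W n)) \<longlonglongrightarrow> l)"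

section \<open>The energy density with spectral splitting\<close>

definition psi0_plus :: "real \<Rightarrow> real \<Rightarrow> 'n::finite symmat \<Rightarrow> real" where
  "psi0_plus lam mu E =
     lam / 2 * (max 0 (\<Sum>i<CARD('n). Eig E ! i))\<^sup>2
     + mu * (\<Sum>i<CARD('n). (max 0 (Eig E ! i))\<^sup>2)"

definition psi0_minus :: "real \<Rightarrow> real \<Rightarrow> 'n::finite symmat \<Rightarrow> real" where
  "psi0_minus lam mu E =
     lam / 2 * (min 0 (\<Sum>i<CARD('n). Eig E ! i))\<^sup>2
     + mu * (\<Sum>i<CARD('n). (min 0 (Eig E ! i))\<^sup>2)"

definition psi ::
  "real \<Rightarrow> real \<Rightarrow> real \<Rightarrow> (real \<Rightarrow> real) \<Rightarrow> 'n::finite symmat \<Rightarrow> real \<Rightarrow> real" where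
  "psi lam mu k g E d = (g d + k) * psi0_plus lam mu E + (1 + k) * psi0_minus lam mu E"

end

theory Submission
  imports Defs
begin

text \<open>
Write $E_+$ for the positive part of a symmetric matrix, obtained by replacing every eigenvalue by its
positive part. The spectral theorem turns the sums over eigenvalues into $|E_+|^2$ and
$|(-E)_+|^2$, so that with $\Phi(E) = \frac{\lambda}{2}\max(0,\mathrm{tr}\,E)^2 + \mu |E_+|^2$ the
energy is $\psi(E,d) = a\,\Phi(E) + b\,\Phi(-E)$ where $0 < k \le a = g(d)+k \le b = 1+k$.

The positive part is the metric projection onto the self-dual cone of positive semidefinite
matrices. It is the unique $X$ such that $X$ and $X - E$ are in the cone and orthogonal to each
other. Together with the nonnegativity of inner products within the cone, this description shows
that it is nonexpansive and that
$|E_+|^2 + 2\langle E_+,H\rangle \le |(E+H)_+|^2 \le |E_+|^2 + 2\langle E_+,H\rangle + |H|^2$. Hence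
$\Phi$ is convex, and it is differentiable with the Lipschitz gradient \<open>stress_plus\<close>. Since
$Q(E) = \Phi(E) + \Phi(-E)$ is a quadratic form with $Q(E) \ge \mu|E|^2$, the decomposition
$\psi = a\,Q + (b-a)\,\Phi(-\,\cdot\,)$ gives strong convexity and coercivity with constants that
come from $a \ge k$.

The gradient of $\psi$ is linear minus $(b-a)$ times the gradient of $\Phi$, so smoothness and
semismoothness are questions about \<open>stress_plus\<close>. It has a kink wherever $E$ is singular, in
particular at $0$; this excludes $C^2$ unless $a = b$, that is, unless $g(d) = 1$, in which case
the energy is quadratic.

For semismoothness it suffices to control $D_n W_n$ for derivatives $D_n$ at points of
differentiability $B_n = A + t_n W_n$ (\<open>semismoothI\<close>). The kinks of the trace term and of the positive
part cannot cancel, so the positive part is itself differentiable at $B_n$, and $B_n$ is invertible. Let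
$D_n$ now be the derivative of the positive part. As $t_n D_n W_n = D_n B_n - D_n A$ and
$D_n B_n = (B_n)_+$ by homogeneity, two facts remain: $D_n A = A_+ + O(t_n^2)$
(\<open>pos_part_strongly_semismooth\<close>), and the existence of the directional derivative of the positive part (\<open>pos_part_directional_derivative\<close>). Both follow
from differentiating, or expanding to first order, the complementarity relation
$E_+ (-E)_+ = 0$, which in an eigenbasis becomes a scalar equation for every matrix entry.
\<close>

section \<open>The spectral theorem\<close>

text \<open>
A maximiser \<open>u\<close> of the Rayleigh quotient on the unit sphere of the subspace is an eigenvector: with
\<open>c\<close> the maximum, the form $c|v|^2 - \langle v, Tv\rangle$ is nonnegative on the subspace and vanishes
at \<open>u\<close>, so its first variation at \<open>u\<close> in the direction $z = cu - Tu$ vanishes, which says $|z|^2 = 0$.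
\<close>

lemma eigenvector_in_invariant_subspace:
  fixes T :: "'a::euclidean_space \<Rightarrow> 'a"
  assumes lin: "linear T" and sym: "\<And>u v. u \<bullet> T v = T u \<bullet> v"
    and S: "subspace S" "S \<noteq> {0}" and inv: "\<And>v. v \<in> S \<Longrightarrow> T v \<in> S"
  obtains u c where "u \<in> S" "norm u = 1" "T u = c *\<^sub>R u"
proof -
  let ?K = "S \<inter> sphere 0 1"
  obtain w where w: "w \<in> S" "w \<noteq> 0" using S subspace_0 by blast
  then have "w /\<^sub>R norm w \<in> ?K" using S(1) by (simp add: subspace_scale)
  then have ne: "?K \<noteq> {}" by blast
  have "compact ?K" using S(1) by (simp add: closed_Int_compact closed_subspace)
  moreover have "continuous_on ?K (\<lambda>v. v \<bullet> T v)"
    using lin by (intro continuous_intros linear_continuous_on linear_conv_bounded_linear[THEN iffD1])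
  ultimately obtain u where u: "u \<in> ?K" "\<And>v. v \<in> ?K \<Longrightarrow> v \<bullet> T v \<le> u \<bullet> T u"
    using continuous_attains_sup ne by metis
  define c where "c = u \<bullet> T u"
  have Rayleigh: "v \<bullet> T v \<le> c * (v \<bullet> v)" if "v \<in> S" for v
  proof (cases "v = 0")
    case False
    have "(v /\<^sub>R norm v) \<bullet> T (v /\<^sub>R norm v) \<le> c"
      unfolding c_def using that False S(1) by (intro u(2)) (simp add: subspace_scale)
    then have "(v \<bullet> T v) / (norm v)\<^sup>2 \<le> c"
      by (simp add: linear_scale[OF lin] power2_eq_square divide_inverse mult_ac)
    then show ?thesis using False by (simp add: field_simps power2_norm_eq_inner)
  qed (simp add: linear_0[OF lin])
  define z where "z = c *\<^sub>R u - T u"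
  have zS: "z \<in> S" unfolding z_def using S(1) u(1) inv by (simp add: subspace_diff subspace_scale)
  have uu: "u \<bullet> u = 1" using u(1) by (simp add: norm_eq_1)
  define b where "b = c * (z \<bullet> z) - z \<bullet> T z"
  have pos: "0 \<le> 2 * s * (z \<bullet> z) + s\<^sup>2 * b" for s
  proof -
    have "0 \<le> c * ((u + s *\<^sub>R z) \<bullet> (u + s *\<^sub>R z)) - (u + s *\<^sub>R z) \<bullet> T (u + s *\<^sub>R z)"
      using Rayleigh[of "u + s *\<^sub>R z"] u(1) zS S(1) by (simp add: subspace_add subspace_scale)
    also have "\<dots> = c * (u \<bullet> u) - u \<bullet> T u + 2 * s * (c * (u \<bullet> z) - T u \<bullet> z) + s\<^sup>2 * b"
      using sym[of u z] by (simp add: b_def linear_add[OF lin] linear_scale[OF lin] inner_add_left inner_add_right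
          inner_commute algebra_simps power2_eq_square)
    also have "c * (u \<bullet> z) - T u \<bullet> z = z \<bullet> z"
      by (simp add: z_def inner_diff_left)
    finally show ?thesis by (simp add: uu c_def)
  qed
  have "z \<bullet> z = 0"
  proof (rule ccontr)
    assume "z \<bullet> z \<noteq> 0"
    then have zz: "z \<bullet> z > 0" by simp
    \<comment> \<open>A negative step, short enough for the linear term to dominate the quadratic one.\<close>
    define s where "s = - (z \<bullet> z) / (\<bar>b\<bar> + 1)"
    have "2 * s * (z \<bullet> z) + s\<^sup>2 * b = s * (2 * (z \<bullet> z) + s * b)"
      by (simp add: algebra_simps power2_eq_square)
    moreover have "\<bar>s * b\<bar> < 2 * (z \<bullet> z)"
    proof -
      have "\<bar>s * b\<bar> = (z \<bullet> z) * (\<bar>b\<bar> / (\<bar>b\<bar> + 1))" using zz by (simp add: s_def abs_mult)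
      also have "\<dots> \<le> (z \<bullet> z) * 1" by (intro mult_left_mono) auto
      finally show ?thesis using zz by linarith
    qed
    moreover have "s < 0" using zz by (simp add: s_def field_simps)
    ultimately have "2 * s * (z \<bullet> z) + s\<^sup>2 * b < 0"
      by (simp add: mult_neg_pos)
    then show False using pos[of s] by linarith
  qed
  then have "T u = c *\<^sub>R u" by (simp add: z_def)
  then show thesis using that u(1) by auto
qed

definition orthonormal :: "('n::finite \<Rightarrow> real^'n) \<Rightarrow> bool" where
  "orthonormal q \<longleftrightarrow> (\<forall>i j. q i \<bullet> q j = (if i = j then 1 else 0))"

lemma orthonormal_axis: "orthonormal (\<lambda>i. axis i 1)"
  by (simp add: orthonormal_def inner_axis_axis)

lemma norm_orthonormal: "orthonormal q \<Longrightarrow> norm (q i) = 1"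
  by (simp add: orthonormal_def norm_eq_1)

lemma orthonormal_expansion:
  assumes q: "orthonormal (q :: 'n::finite \<Rightarrow> real^'n)"
  shows "(\<Sum>i\<in>UNIV. (v \<bullet> q i) *\<^sub>R q i) = v"
proof -
  have inj: "inj q"
  proof (rule injI)
    fix i j assume "q i = q j"
    then have "q i \<bullet> q j = 1" using q by (simp add: orthonormal_def)
    then show "i = j" using q by (auto simp: orthonormal_def split: if_splits)
  qed
  have "pairwise orthogonal (range q)"
    using q by (auto simp: pairwise_def orthogonal_def orthonormal_def)
  moreover have "0 \<notin> range q"
    using norm_orthonormal[OF q] by (metis imageE norm_zero zero_neq_one)
  ultimately have "independent (range q)" by (rule pairwise_orthogonal_independent)
  then have span: "span (range q) = UNIV"
    using card_eq_dim[of "range q" UNIV] card_image[OF inj] by (simp add: dim_UNIV top.extremum_unique)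
  let ?w = "v - (\<Sum>i\<in>UNIV. (v \<bullet> q i) *\<^sub>R q i)"
  have "orthogonal ?w x" if x: "x \<in> range q" for x
  proof -
    obtain k where k: "x = q k" using x by blast
    have "(\<Sum>i\<in>UNIV. (v \<bullet> q i) * (q i \<bullet> q k)) = (\<Sum>i\<in>UNIV. if i = k then v \<bullet> q k else 0)"
      using q by (intro sum.cong) (auto simp: orthonormal_def)
    then show ?thesis by (simp add: k orthogonal_def inner_diff_left inner_sum_left)
  qed
  then have "orthogonal ?w ?w" using span orthogonal_to_span by blast
  then show ?thesis by (simp add: orthogonal_def)
qed

lemma Parseval:
  assumes "orthonormal (q :: 'n::finite \<Rightarrow> real^'n)"
  shows "u \<bullet> v = (\<Sum>i\<in>UNIV. (u \<bullet> q i) * (v \<bullet> q i))"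
proof -
  have "u \<bullet> v = u \<bullet> (\<Sum>i\<in>UNIV. (v \<bullet> q i) *\<^sub>R q i)" using orthonormal_expansion[OF assms] by simp
  then show ?thesis by (simp add: inner_sum_right mult.commute)
qed

definition act :: "'n::finite symmat \<Rightarrow> real^'n \<Rightarrow> real^'n" where
  "act A v = mat_of A *v v"

lemma act_simps [simp]:
  "act A (u + v) = act A u + act A v" "act A (u - v) = act A u - act A v"
  "act A (c *\<^sub>R v) = c *\<^sub>R act A v" "act A (- v) = - act A v" "act A 0 = 0"
  "act (A + B) v = act A v + act B v" "act (A - B) v = act A v - act B v"
  "act (c *\<^sub>R A) v = c *\<^sub>R act A v" "act (- A) v = - act A v" "act 0 v = 0"
  by (simp_all add: act_def plus_symmat.rep_eq minus_symmat.rep_eq uminus_symmat.rep_eq zero_symmat.rep_eq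
      scaleR_symmat.rep_eq matrix_vector_right_distrib matrix_vector_mult_add_rdistrib
      matrix_vector_mult_diff_distrib matrix_vector_mult_diff_rdistrib
      vec_eq_iff matrix_vector_mult_def sum_negf sum_distrib_left sum.distrib sum_subtractf algebra_simps)

lemma act_sum_left: "act (\<Sum>i\<in>I. A i) v = (\<Sum>i\<in>I. act (A i) v)"
  by (induction I rule: infinite_finite_induct) auto

lemma act_self_adjoint: "act A u \<bullet> v = u \<bullet> act A v"
proof -
  have "transpose (mat_of A) = mat_of A" using mat_of[of A] by simp
  then show ?thesis by (metis act_def dot_lmul_matrix vector_transpose_matrix)
qed

lemma linear_act: "linear (act A)"
  by (rule linearI) simp_all

text \<open>
Among the orthonormal sets of eigenvectors take one of maximal cardinality. Its orthogonal complement
is invariant, and an eigenvector in it would enlarge the set, so the complement is zero.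
\<close>

lemma spectral_basis:
  fixes A :: "'n::finite symmat"
  obtains q b where "orthonormal q" "\<And>i. act A (q i) = b i *\<^sub>R q i"
proof -
  define eig where "eig B \<longleftrightarrow> pairwise orthogonal B \<and>
    (\<forall>u\<in>B. norm u = 1 \<and> (\<exists>c. act A u = c *\<^sub>R u))" for B :: "(real^'n) set"
  have indep: "independent B" if "eig B" for B
    using that by (intro pairwise_orthogonal_independent) (auto simp: eig_def)
  have fin: "finite B" if "eig B" for B using indep[OF that] by (rule independent_imp_finite)
  have bd: "card B \<le> CARD('n)" if "eig B" for B
    using independent_card_le[OF indep[OF that]] by simp
  have "eig {}" by (simp add: eig_def)
  then obtain B where B: "eig B" "\<And>C. eig C \<Longrightarrow> card C \<le> card B"
    using ex_has_greatest_nat[of eig "{}" card "Suc CARD('n)"] bd by (auto simp: less_Suc_eq_le)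
  let ?S = "{v. \<forall>u\<in>B. u \<bullet> v = 0}"
  have sub: "subspace ?S" by (simp add: subspace_def inner_add_right)
  have inv: "act A v \<in> ?S" if "v \<in> ?S" for v
  proof (clarsimp)
    fix u assume "u \<in> B"
    then obtain c where "act A u = c *\<^sub>R u" using B(1) by (auto simp: eig_def)
    then show "u \<bullet> act A v = 0" using that \<open>u \<in> B\<close> by (simp add: act_self_adjoint[symmetric])
  qed
  have "?S = {0}"
  proof (rule ccontr)
    assume "?S \<noteq> {0}"
    then obtain u c where u: "u \<in> ?S" "norm u = 1" "act A u = c *\<^sub>R u"
      by (rule eigenvector_in_invariant_subspace[OF linear_act act_self_adjoint[symmetric] sub])
        (use inv in auto)
    have "u \<notin> B" using u by auto
    moreover have "eig (insert u B)"
      using B(1) u by (auto simp: eig_def pairwise_insert orthogonal_def inner_commute)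
    ultimately show False using B(2)[of "insert u B"] fin[OF B(1)] by simp
  qed
  then have "span B = UNIV"
  proof -
    have "x \<in> span B" for x
    proof -
      obtain y z where yz: "y \<in> span B" "\<And>w. w \<in> span B \<Longrightarrow> orthogonal z w" "x = y + z"
        using orthogonal_subspace_decomp_exists by blast
      then have "z \<in> ?S" by (auto simp: orthogonal_def inner_commute span_base)
      then show ?thesis using yz \<open>?S = {0}\<close> by simp
    qed
    then show ?thesis by blast
  qed
  then have "card B = CARD('n)"
    using basis_card_eq_dim[of B UNIV] indep[OF B(1)] by (simp add: dim_UNIV)
  then obtain q where q: "bij_betw q (UNIV :: 'n set) B"
    using fin[OF B(1)] finite_same_card_bij[of "UNIV :: 'n set" B] by auto
  have "orthonormal q"
    unfolding orthonormal_def
  proof (intro allI)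
    fix i j
    have "q i \<in> B" "q j \<in> B" using q by (auto simp: bij_betw_def)
    moreover have "i = j" if "q i = q j" using q that by (simp add: bij_betw_def inj_eq)
    ultimately show "q i \<bullet> q j = (if i = j then 1 else 0)"
      using B(1) by (auto simp: eig_def pairwise_def orthogonal_def norm_eq_1)
  qed
  moreover have "\<exists>b. \<forall>i. act A (q i) = b i *\<^sub>R q i"
    using B(1) q by (intro choice) (auto simp: eig_def bij_betw_def)
  ultimately show thesis using that by blast
qed

section \<open>Sums over the eigenvalues\<close>

lemma map_matrix_const_mult:
  fixes A B :: "real^'n^'n"
  shows "map_matrix (\<lambda>a. [:a:]) (A ** B) = map_matrix (\<lambda>a. [:a:]) A ** map_matrix (\<lambda>a. [:a:]) B"
proof -
  have "[:\<Sum>k\<in>K. f k:] = (\<Sum>k\<in>K. [:f k:])" for f :: "'n \<Rightarrow> real" and K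
  proof (induction K rule: infinite_finite_induct)
    case (insert x F)
    have "[:f x + sum f F:] = [:f x:] + [:sum f F:]" by simp
    then show ?case using insert by simp
  qed auto
  then show ?thesis by (simp add: vec_eq_iff map_matrix_def matrix_matrix_mult_def mult_ac)
qed

text \<open>
For the matrix \<open>Q\<close> with columns \<open>q i\<close> the eigenvalue equations read $AQ = QD$. The determinant of $Q$,
a unit, is cancelled from $\det(XI - A)\det Q = \det Q\,\det(XI - D)$ over the polynomial ring.
\<close>

lemma charpoly_eigenbasis:
  fixes A :: "'n::finite symmat"
  assumes q: "orthonormal q" and b: "\<And>i. act A (q i) = b i *\<^sub>R q i"
  shows "charpoly (mat_of A) = (\<Prod>i\<in>UNIV. [:- b i, 1:])"
proof -
  define c :: "real^'n^'n \<Rightarrow> real poly^'n^'n" where "c = map_matrix (\<lambda>a. [:a:])"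
  define Q D :: "real^'n^'n" where "Q = (\<chi> i j. q j $ i)" and "D = (\<chi> i j. if i = j then b i else 0)"
  define X :: "real poly^'n^'n" where "X = mat [:0, 1:]"
  have "(mat_of A ** Q) $ i $ j = (Q ** D) $ i $ j" for i j
  proof -
    have "(mat_of A ** Q) $ i $ j = act A (q j) $ i"
      by (simp add: act_def matrix_matrix_mult_def matrix_vector_mult_def Q_def)
    also have "\<dots> = (Q ** D) $ i $ j"
      by (simp add: b matrix_matrix_mult_def Q_def D_def if_distrib[of "\<lambda>x. _ * x"] mult.commute cong: if_cong)
    finally show ?thesis .
  qed
  then have AQ: "c (mat_of A) ** c Q = c Q ** c D"
    unfolding c_def by (simp add: vec_eq_iff flip: map_matrix_const_mult)
  have "transpose Q ** Q = mat 1"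
    using q by (simp add: vec_eq_iff matrix_matrix_mult_def transpose_def Q_def mat_def orthonormal_def inner_vec_def)
  then have "c (transpose Q) ** c Q = mat 1"
    unfolding c_def map_matrix_const_mult[symmetric] by (simp add: vec_eq_iff map_matrix_def mat_def)
  then have "det (c (transpose Q)) * det (c Q) = 1" by (metis det_I det_mul)
  then have ne: "det (c Q) \<noteq> 0" by auto
  have "X ** M = M ** X" for M
    by (simp add: X_def vec_eq_iff matrix_matrix_mult_def mat_def if_distrib[of "\<lambda>x. x * _"]
        if_distrib[of "\<lambda>x. _ * x"] mult.commute cong: if_cong)
  then have "(X - c (mat_of A)) ** c Q = c Q ** (X - c D)"
    using AQ by (simp add: vec_eq_iff matrix_matrix_mult_def left_diff_distrib right_diff_distrib sum_subtractf)
  then have "det (X - c (mat_of A)) * det (c Q) = det (X - c D) * det (c Q)"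
    by (metis det_mul mult.commute)
  with ne have "det (X - c (mat_of A)) = det (X - c D)" by simp
  also have "\<dots> = (\<Prod>i\<in>UNIV. (X - c D) $ i $ i)"
    by (rule det_diagonal) (simp add: X_def c_def D_def map_matrix_def mat_def)
  also have "\<dots> = (\<Prod>i\<in>UNIV. [:- b i, 1:])"
    by (simp add: X_def c_def D_def map_matrix_def mat_def)
  finally show ?thesis by (simp add: charpoly_def X_def c_def)
qed

text \<open>
The sorted list of eigenvalues is only needed through symmetric functions; this lemma replaces it by
the eigenvalues of any orthonormal eigenbasis, in whatever order they come.
\<close>

lemma sum_Eig_eigenbasis:
  fixes A :: "'n::finite symmat"
  assumes q: "orthonormal q" and b: "\<And>i. act A (q i) = b i *\<^sub>R q i"
  shows "(\<Sum>i<CARD('n). f (Eig A ! i)) = (\<Sum>i\<in>UNIV. f (b i) :: real)"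
proof -
  have "proots (charpoly (mat_of A)) = (\<Sum>i\<in>UNIV. proots [:- b i, 1:])"
    unfolding charpoly_eigenbasis[OF assms] by (rule proots_prod) auto
  also have "\<dots> = image_mset b (mset_set UNIV)"
    by (simp add: sum_unfold_sum_mset)
  finally have mset: "mset (Eig A) = image_mset b (mset_set UNIV)"
    unfolding Eig_def by simp
  have "length (Eig A) = CARD('n)"
    using arg_cong[OF mset, of size] by simp
  then have "(\<Sum>i<CARD('n). f (Eig A ! i)) = sum_list (map f (Eig A))"
    by (simp add: sum_list_sum_nth atLeast0LessThan)
  also have "\<dots> = sum_mset (image_mset f (mset (Eig A)))"
    by (simp flip: sum_mset_sum_list)
  also have "\<dots> = (\<Sum>i\<in>UNIV. f (b i))"
    by (simp add: mset sum_unfold_sum_mset multiset.map_comp comp_def)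
  finally show ?thesis .
qed

section \<open>The Frobenius inner product in an orthonormal basis\<close>

text \<open>
The columns of a matrix are its values on the standard basis, and $\mathrm{tr}(AB)$ does not depend
on the orthonormal basis in which it is computed.
\<close>

lemma inner_symmat_orthonormal:
  assumes q: "orthonormal q"
  shows "A \<bullet> B = (\<Sum>i\<in>UNIV. act A (q i) \<bullet> act B (q i))"
proof -
  let ?e = "\<lambda>j. axis j (1::real)"
  have "A \<bullet> B = (\<Sum>k\<in>UNIV. \<Sum>j\<in>UNIV. mat_of A $ k $ j * mat_of B $ k $ j)"
    by (simp add: inner_symmat.rep_eq inner_vec_def)
  also have "\<dots> = (\<Sum>j\<in>UNIV. \<Sum>k\<in>UNIV. mat_of A $ k $ j * mat_of B $ k $ j)"
    by (rule sum.swap)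
  also have "\<dots> = (\<Sum>j\<in>UNIV. act A (?e j) \<bullet> act B (?e j))"
    by (simp add: act_def inner_vec_def matrix_vector_mult_basis column_def)
  also have "\<dots> = (\<Sum>j\<in>UNIV. \<Sum>i\<in>UNIV. (?e j \<bullet> act A (q i)) * (?e j \<bullet> act B (q i)))"
    by (subst Parseval[OF q]) (simp add: act_self_adjoint)
  also have "\<dots> = (\<Sum>i\<in>UNIV. \<Sum>j\<in>UNIV. (act A (q i) \<bullet> ?e j) * (act B (q i) \<bullet> ?e j))"
    by (subst sum.swap) (simp add: inner_commute)
  also have "\<dots> = (\<Sum>i\<in>UNIV. act A (q i) \<bullet> act B (q i))"
    by (subst Parseval[OF orthonormal_axis]) simp
  finally show ?thesis .
qed

lemma norm_act_le: "norm (act A v) \<le> norm A * norm v"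
proof -
  let ?e = "\<lambda>j. axis j (1::real)"
  have "(norm (act A v))\<^sup>2 = (\<Sum>i\<in>UNIV. (v \<bullet> act A (?e i))\<^sup>2)"
    unfolding power2_norm_eq_inner[of "act A v"]
    by (subst Parseval[OF orthonormal_axis]) (simp add: act_self_adjoint power2_eq_square)
  also have "\<dots> \<le> (\<Sum>i\<in>UNIV. (norm v)\<^sup>2 * (norm (act A (?e i)))\<^sup>2)"
    by (intro sum_mono) (metis Cauchy_Schwarz_ineq power2_norm_eq_inner)
  also have "\<dots> = (norm A * norm v)\<^sup>2"
    by (simp add: power2_norm_eq_inner[of A] inner_symmat_orthonormal[OF orthonormal_axis]
        power_mult_distrib power2_norm_eq_inner[of "act A _"] flip: sum_distrib_left)
  finally show ?thesis by (rule power2_le_imp_le) simp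
qed

lemma act_entry_le: "orthonormal q \<Longrightarrow> orthonormal p \<Longrightarrow> \<bar>q i \<bullet> act A (p j)\<bar> \<le> norm A"
  using Cauchy_Schwarz_ineq2[of "q i" "act A (p j)"] norm_act_le[of A "p j"]
  by (simp add: norm_orthonormal)

lemma sum_power2_le_power2_sum:
  fixes f :: "'a \<Rightarrow> real"
  assumes "\<And>i. i \<in> I \<Longrightarrow> 0 \<le> f i"
  shows "(\<Sum>i\<in>I. (f i)\<^sup>2) \<le> (\<Sum>i\<in>I. f i)\<^sup>2"
  using assms
proof (induction I rule: infinite_finite_induct)
  case (insert x F)
  then have "0 \<le> f x * sum f F" by (intro mult_nonneg_nonneg sum_nonneg) auto
  with insert show ?case by (simp add: power2_sum)
qed auto

text \<open>
A crude comparison of norms, which reduces estimates of a matrix to estimates of its entries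
\<open>q i \<bullet> act A (q j)\<close> in an orthonormal basis.
\<close>

lemma norm_symmat_le_sum_entries:
  assumes q: "orthonormal q"
  shows "norm A \<le> (\<Sum>i\<in>UNIV. \<Sum>j\<in>UNIV. \<bar>q i \<bullet> act A (q j)\<bar>)"
proof (rule power2_le_imp_le)
  have "(norm A)\<^sup>2 = (\<Sum>j\<in>UNIV. \<Sum>i\<in>UNIV. \<bar>q i \<bullet> act A (q j)\<bar>\<^sup>2)"
    unfolding power2_norm_eq_inner inner_symmat_orthonormal[OF q]
    by (subst Parseval[OF q]) (simp add: inner_commute power2_eq_square)
  also have "\<dots> \<le> (\<Sum>j\<in>UNIV. (\<Sum>i\<in>UNIV. \<bar>q i \<bullet> act A (q j)\<bar>)\<^sup>2)"
    by (intro sum_mono sum_power2_le_power2_sum) auto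
  also have "\<dots> \<le> (\<Sum>j\<in>UNIV. \<Sum>i\<in>UNIV. \<bar>q i \<bullet> act A (q j)\<bar>)\<^sup>2"
    by (intro sum_power2_le_power2_sum) (auto intro: sum_nonneg)
  finally show "(norm A)\<^sup>2 \<le> (\<Sum>i\<in>UNIV. \<Sum>j\<in>UNIV. \<bar>q i \<bullet> act A (q j)\<bar>)\<^sup>2"
    by (subst sum.swap)
qed (auto intro: sum_nonneg)

lemma symmat_eqI:
  assumes "orthonormal q" "\<And>i. act A (q i) = act B (q i)"
  shows "A = B"
proof -
  have "norm (A - B) \<le> 0" using norm_symmat_le_sum_entries[OF assms(1), of "A - B"] assms(2) by simp
  then show ?thesis by simp
qed

lift_definition outer :: "real^'n \<Rightarrow> 'n::finite symmat" is "\<lambda>u. \<chi> i j. u $ i * u $ j"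
  by (simp add: transpose_def vec_eq_iff mult.commute)

lemma act_outer [simp]: "act (outer u) v = (u \<bullet> v) *\<^sub>R u"
  by (simp add: act_def outer.rep_eq vec_eq_iff matrix_vector_mult_def inner_vec_def sum_distrib_left
      sum_distrib_right mult_ac)

lemma inner_outer: "A \<bullet> outer u = u \<bullet> act A u"
proof -
  have "A \<bullet> outer u = (\<Sum>i\<in>UNIV. (u \<bullet> axis i 1) * (act A u \<bullet> axis i 1))"
    unfolding inner_symmat_orthonormal[OF orthonormal_axis]
  proof (intro sum.cong refl)
    fix i :: 'a
    have "act A (axis i 1) \<bullet> u = act A u \<bullet> axis i 1" by (metis act_self_adjoint inner_commute)
    then show "act A (axis i 1) \<bullet> act (outer u) (axis i 1) = (u \<bullet> axis i 1) * (act A u \<bullet> axis i 1)"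
      by simp
  qed
  then show ?thesis using Parseval[OF orthonormal_axis, of u "act A u"] by simp
qed

lift_definition identity :: "'n::finite symmat" is "mat 1" by simp

lemma act_identity [simp]: "act identity v = v"
  by (simp add: act_def identity.rep_eq)

lemma trace_orthonormal:
  "orthonormal q \<Longrightarrow> A \<bullet> identity = (\<Sum>i\<in>UNIV. q i \<bullet> act A (q i))"
  by (simp add: inner_symmat_orthonormal inner_commute)

section \<open>The positive part as a projection onto a self-dual cone\<close>

definition psd :: "'n::finite symmat \<Rightarrow> bool" where
  "psd A \<longleftrightarrow> (\<forall>v. 0 \<le> v \<bullet> act A v)"

text \<open>
The half of self-duality of the semidefinite cone that all estimates of the positive part rest on. In an
eigenbasis of \<open>A\<close> the inner product is a sum of diagonal entries of \<open>B\<close> with nonnegative weights.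
\<close>

lemma inner_psd_nonneg:
  assumes "psd A" "psd B" shows "0 \<le> A \<bullet> B"
proof -
  obtain q a where q: "orthonormal q" "\<And>i. act A (q i) = a i *\<^sub>R q i"
    using spectral_basis[of A] by blast
  have "0 \<le> a i" for i
  proof -
    have "q i \<bullet> act A (q i) = a i" using q by (simp add: orthonormal_def)
    then show ?thesis using assms(1) by (auto simp: psd_def dest: spec[of _ "q i"])
  qed
  then show ?thesis
    using assms(2) by (auto simp: inner_symmat_orthonormal[OF q(1)] q(2) psd_def intro!: sum_nonneg)
qed

text \<open>
The optimality conditions for the metric projection of \<open>E\<close> onto the cone of positive semidefinite
matrices; \<open>X - E\<close> is then the positive part of \<open>- E\<close>.
\<close>

definition is_pos_part :: "'n::finite symmat \<Rightarrow> 'n symmat \<Rightarrow> bool" where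
  "is_pos_part E X \<longleftrightarrow> psd X \<and> psd (X - E) \<and> X \<bullet> (X - E) = 0"

text \<open>
Subtract the two orthogonality relations; the mixed terms have a sign by self-duality of the cone.
Uniqueness and nonexpansiveness of the positive part are immediate consequences.
\<close>

lemma is_pos_part_monotone:
  assumes "is_pos_part A X" "is_pos_part B Y"
  shows "(norm (X - Y))\<^sup>2 \<le> (X - Y) \<bullet> (A - B)"
proof -
  have "0 \<le> X \<bullet> (Y - B)" "0 \<le> Y \<bullet> (X - A)"
    using assms inner_psd_nonneg by (auto simp: is_pos_part_def)
  then show ?thesis
    using assms by (simp add: is_pos_part_def power2_norm_eq_inner algebra_simps inner_commute)
qed

lemma is_pos_part_unique: "is_pos_part E X \<Longrightarrow> is_pos_part E Y \<Longrightarrow> X = Y"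
  using is_pos_part_monotone[of E X E Y] by simp

lemma is_pos_part_spectral:
  assumes q: "orthonormal q" and b: "\<And>i. act E (q i) = b i *\<^sub>R q i"
  shows "is_pos_part E (\<Sum>i\<in>UNIV. max 0 (b i) *\<^sub>R outer (q i))" (is "is_pos_part E ?X")
    and "act (\<Sum>i\<in>UNIV. max 0 (b i) *\<^sub>R outer (q i)) (q j) = max 0 (b j) *\<^sub>R q j"
proof -
  show X: "act ?X (q j) = max 0 (b j) *\<^sub>R q j" for j
  proof -
    have "act ?X (q j) = (\<Sum>i\<in>UNIV. if i = j then max 0 (b j) *\<^sub>R q j else 0)"
      using q unfolding act_sum_left by (intro sum.cong) (auto simp: orthonormal_def)
    then show ?thesis by simp
  qed
  have E: "E = (\<Sum>i\<in>UNIV. b i *\<^sub>R outer (q i))"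
  proof (rule symmat_eqI[OF q])
    fix j
    have "act (\<Sum>i\<in>UNIV. b i *\<^sub>R outer (q i)) (q j) = (\<Sum>i\<in>UNIV. if i = j then b j *\<^sub>R q j else 0)"
      using q unfolding act_sum_left by (intro sum.cong) (auto simp: orthonormal_def)
    then show "act E (q j) = act (\<Sum>i\<in>UNIV. b i *\<^sub>R outer (q i)) (q j)" by (simp add: b)
  qed
  have psd: "psd (\<Sum>i\<in>UNIV. c i *\<^sub>R outer (q i))" if "\<And>i. 0 \<le> c i" for c
    using that by (auto simp: psd_def act_sum_left inner_sum_right inner_commute mult.assoc intro!: sum_nonneg)
  have "psd (?X - E)"
  proof -
    have "?X - E = (\<Sum>i\<in>UNIV. (max 0 (b i) - b i) *\<^sub>R outer (q i))"
      by (simp add: E scaleR_left_diff_distrib sum_subtractf)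
    then show ?thesis by (simp only:) (rule psd, simp)
  qed
  moreover have "?X \<bullet> (?X - E) = 0"
    unfolding inner_symmat_orthonormal[OF q]
    by (intro sum.neutral ballI) (simp only: act_simps X b, auto simp: max_def simp flip: scaleR_left_diff_distrib)
  ultimately show "is_pos_part E ?X" using psd[of "\<lambda>i. max 0 (b i)"] by (simp add: is_pos_part_def)
qed

definition pos_part :: "'n::finite symmat \<Rightarrow> 'n symmat" where
  "pos_part E = (THE X. is_pos_part E X)"

lemma pos_part_eqI: "is_pos_part E X \<Longrightarrow> pos_part E = X"
  unfolding pos_part_def using is_pos_part_unique by blast

lemma is_pos_part_pos_part: "is_pos_part E (pos_part E)"
proof -
  obtain q b where "orthonormal q" "\<And>i. act E (q i) = b i *\<^sub>R q i"
    using spectral_basis[of E] by blast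
  from is_pos_part_spectral(1)[OF this] show ?thesis by (simp add: pos_part_eqI)
qed

lemma psd_pos_part: "psd (pos_part E)" "psd (pos_part E - E)"
  and inner_pos_part: "pos_part E \<bullet> (pos_part E - E) = 0"
  using is_pos_part_pos_part[of E] by (auto simp: is_pos_part_def)

lemma act_pos_part:
  assumes "orthonormal q" "\<And>i. act E (q i) = b i *\<^sub>R q i"
  shows "act (pos_part E) (q i) = max 0 (b i) *\<^sub>R q i"
  using is_pos_part_spectral[OF assms] by (simp add: pos_part_eqI)

text \<open>
Moreau's decomposition $E = E_+ - (-E)_+$: the optimality conditions are symmetric in the two parts.
\<close>

lemma pos_part_minus: "pos_part (- E) = pos_part E - E"
  by (rule pos_part_eqI) (use psd_pos_part[of E] inner_pos_part[of E] in \<open>simp add: is_pos_part_def inner_commute\<close>)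

lemma pos_part_nonexpansive: "norm (pos_part A - pos_part B) \<le> norm (A - B)"
proof -
  have "(norm (pos_part A - pos_part B))\<^sup>2 \<le> norm (pos_part A - pos_part B) * norm (A - B)"
    using is_pos_part_monotone[OF is_pos_part_pos_part is_pos_part_pos_part, of A B]
      norm_cauchy_schwarz[of "pos_part A - pos_part B" "A - B"] by linarith
  then show ?thesis by (cases "pos_part A = pos_part B") (auto simp: power2_eq_square)
qed

lemma norm_pos_part_sq:
  assumes "orthonormal q" "\<And>i. act E (q i) = b i *\<^sub>R q i"
  shows "(norm (pos_part E))\<^sup>2 = (\<Sum>i\<in>UNIV. (max 0 (b i))\<^sup>2)"
  using assms(1) unfolding power2_norm_eq_inner inner_symmat_orthonormal[OF assms(1)] act_pos_part[OF assms]
  by (simp add: power2_eq_square orthonormal_def)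

lemma norm_sq_pos_part: "(norm E)\<^sup>2 = (norm (pos_part E))\<^sup>2 + (norm (pos_part (- E)))\<^sup>2"
  using inner_pos_part[of E] by (simp add: pos_part_minus power2_norm_eq_inner inner_commute algebra_simps)

text \<open>
This and the next lemma sandwich $|E_+|^2$ between its first-order expansion and the same plus
$|H|^2$, so that $2E_+$ is its gradient. Both bounds complete a square and use that $E_+$ and
$(E+H)_+$ have nonnegative inner product with $(E+H)_+ - (E+H)$ and $E_+ - E$, respectively.
\<close>

lemma norm_pos_part_sq_lower:
  "(norm (pos_part E))\<^sup>2 + 2 * (pos_part E \<bullet> H) \<le> (norm (pos_part (E + H)))\<^sup>2"
proof -
  have "0 \<le> pos_part E \<bullet> (pos_part (E + H) - (E + H))"
    by (intro inner_psd_nonneg psd_pos_part)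
  moreover have "0 \<le> (norm (pos_part (E + H) - pos_part E))\<^sup>2" by simp
  ultimately show ?thesis
    using inner_pos_part[of E] unfolding power2_norm_eq_inner
    by (simp add: inner_commute algebra_simps)
qed

lemma norm_pos_part_sq_upper:
  "(norm (pos_part (E + H)))\<^sup>2 \<le> (norm (pos_part E))\<^sup>2 + 2 * (pos_part E \<bullet> H) + (norm H)\<^sup>2"
proof -
  have "0 \<le> pos_part (E + H) \<bullet> (pos_part E - E)"
    by (intro inner_psd_nonneg psd_pos_part)
  moreover have "0 \<le> (norm (pos_part (E + H) - (pos_part E + H)))\<^sup>2" by simp
  ultimately show ?thesis
    using inner_pos_part[of "E + H"] unfolding power2_norm_eq_inner
    by (simp add: inner_commute algebra_simps)
qed

text \<open>
The complementarity relation $E_+ (-E)_+ = 0$ as an identity of operators. It is the source of the formulas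
for derivatives and directional derivatives of the positive part.
\<close>

lemma pos_part_orthogonal: "act (pos_part E) u \<bullet> act (pos_part (- E)) v = 0"
proof -
  obtain q b where q: "orthonormal q" and b: "\<And>i. act E (q i) = b i *\<^sub>R q i"
    using spectral_basis[of E] by blast
  have b': "act (- E) (q i) = (- b i) *\<^sub>R q i" for i by (simp add: b)
  have "(act (pos_part E) u \<bullet> q i) * (act (pos_part (- E)) v \<bullet> q i) = 0" for i
    unfolding act_self_adjoint act_pos_part[OF q b] act_pos_part[OF q b'] by (simp add: max_def)
  then show ?thesis
    using Parseval[OF q, of "act (pos_part E) u" "act (pos_part (- E)) v"] by (simp only: sum.neutral_const)
qed

lemma pos_part_kernel: "act E v = 0 \<Longrightarrow> act (pos_part E) v = 0"
  using pos_part_orthogonal[of E v v] by (simp add: pos_part_minus)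

section \<open>The energy, its gradient and its convexity\<close>

lemma psi0_plus_eq:
  "psi0_plus lam mu E = lam / 2 * (max 0 (E \<bullet> identity))\<^sup>2 + mu * (norm (pos_part E))\<^sup>2"
proof -
  obtain q b where q: "orthonormal q" and b: "\<And>i. act E (q i) = b i *\<^sub>R q i"
    using spectral_basis[of E] by blast
  have "(\<Sum>i<CARD('a). Eig E ! i) = E \<bullet> identity"
    using q by (simp add: sum_Eig_eigenbasis[OF q b, of "\<lambda>x. x"] trace_orthonormal[OF q] b orthonormal_def)
  then show ?thesis
    by (simp add: psi0_plus_def sum_Eig_eigenbasis[OF q b, of "\<lambda>x. (max 0 x)\<^sup>2"] norm_pos_part_sq[OF q b])
qed

text \<open>
Changing the sign of \<open>E\<close> exchanges positive and negative eigenvalues, so a single function describes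
both halves of the splitting.
\<close>

lemma psi0_minus_eq: "psi0_minus lam mu E = psi0_plus lam mu (- E)"
proof -
  obtain q b where q: "orthonormal q" and b: "\<And>i. act E (q i) = b i *\<^sub>R q i"
    using spectral_basis[of E] by blast
  have b': "act (- E) (q i) = (- b i) *\<^sub>R q i" for i by (simp add: b)
  have "(\<Sum>i<CARD('a). Eig E ! i) = E \<bullet> identity"
    using q by (simp add: sum_Eig_eigenbasis[OF q b, of "\<lambda>x. x"] trace_orthonormal[OF q] b orthonormal_def)
  moreover have sq: "(min 0 x)\<^sup>2 = (max 0 (- x))\<^sup>2" for x :: real by (simp add: min_def max_def)
  ultimately show ?thesis
    using sum_Eig_eigenbasis[OF q b, of "\<lambda>x. (min 0 x)\<^sup>2"]
    by (simp add: psi0_minus_def psi0_plus_eq norm_pos_part_sq[OF q b'])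
qed

lemma psi_eq: "psi lam mu k g E d = (g d + k) * psi0_plus lam mu E + (1 + k) * psi0_plus lam mu (- E)"
  by (simp add: psi_def psi0_minus_eq)

lemma psi0_plus_nonneg: "0 \<le> lam \<Longrightarrow> 0 \<le> mu \<Longrightarrow> 0 \<le> psi0_plus lam mu E"
  by (simp add: psi0_plus_eq)

text \<open>
The full quadratic energy of linear elasticity, which the spectral splitting divides into two parts.
\<close>

definition elastic_energy :: "real \<Rightarrow> real \<Rightarrow> 'n::finite symmat \<Rightarrow> real" where
  "elastic_energy lam mu E = lam / 2 * (E \<bullet> identity)\<^sup>2 + mu * (norm E)\<^sup>2"

lemma psi0_plus_split: "psi0_plus lam mu E + psi0_plus lam mu (- E) = elastic_energy lam mu E"
proof -
  have "(max 0 x)\<^sup>2 + (max 0 (- x))\<^sup>2 = x\<^sup>2" for x :: real by (simp add: max_def)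
  then have "lam / 2 * ((max 0 (E \<bullet> identity))\<^sup>2 + (max 0 (- (E \<bullet> identity)))\<^sup>2) = lam / 2 * (E \<bullet> identity)\<^sup>2"
    by simp
  then show ?thesis
    unfolding psi0_plus_eq elastic_energy_def norm_sq_pos_part[of E] by (simp add: distrib_left)
qed

text \<open>
The gradient of \<open>psi0_plus\<close>; as in mechanics, the gradient of an energy density is called a stress.
\<close>

definition stress_plus :: "real \<Rightarrow> real \<Rightarrow> 'n::finite symmat \<Rightarrow> 'n symmat" where
  "stress_plus lam mu E = (lam * max 0 (E \<bullet> identity)) *\<^sub>R identity + (2 * mu) *\<^sub>R pos_part E"

definition elastic_stress :: "real \<Rightarrow> real \<Rightarrow> 'n::finite symmat \<Rightarrow> 'n symmat" where
  "elastic_stress lam mu E = (lam * (E \<bullet> identity)) *\<^sub>R identity + (2 * mu) *\<^sub>R E"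

lemma stress_plus_split: "stress_plus lam mu E - stress_plus lam mu (- E) = elastic_stress lam mu E"
  by (simp add: stress_plus_def elastic_stress_def pos_part_minus max_def algebra_simps)

text \<open>
The gradient inequality of a convex function. It combines \<open>norm_pos_part_sq_lower\<close> with the same
inequality for the scalar function $x \mapsto \max(0,x)^2$.
\<close>

lemma psi0_plus_lower:
  assumes "0 \<le> lam" "0 \<le> mu"
  shows "psi0_plus lam mu E + stress_plus lam mu E \<bullet> H \<le> psi0_plus lam mu (E + H)"
proof -
  have max: "(max 0 x)\<^sup>2 + 2 * (max 0 x * y) \<le> (max 0 (x + y))\<^sup>2" for x y :: real
  proof -
    consider "x \<le> 0" | "0 < x" "0 \<le> x + y" | "0 < x" "x + y < 0" by linarith
    then show ?thesis
    proof cases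
      case 1
      then show ?thesis by (simp add: max_def)
    next
      case 2
      then show ?thesis by (simp add: max_def power2_sum)
    next
      case 3
      then have "x * (x + 2 * y) \<le> 0" by (intro mult_nonneg_nonpos) auto
      with 3 show ?thesis by (simp add: max_def power2_eq_square algebra_simps)
    qed
  qed
  have "lam / 2 * ((max 0 (E \<bullet> identity))\<^sup>2 + 2 * (max 0 (E \<bullet> identity) * (H \<bullet> identity)))
      \<le> lam / 2 * (max 0 ((E + H) \<bullet> identity))\<^sup>2"
    using assms(1) max[of "E \<bullet> identity" "H \<bullet> identity"] by (intro mult_left_mono) (simp_all add: inner_add_left)
  moreover have "mu * ((norm (pos_part E))\<^sup>2 + 2 * (pos_part E \<bullet> H)) \<le> mu * (norm (pos_part (E + H)))\<^sup>2"
    using assms(2) norm_pos_part_sq_lower[of E H] by (intro mult_left_mono)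
  ultimately show ?thesis
    by (simp add: psi0_plus_eq stress_plus_def inner_commute[of _ H] inner_add_right algebra_simps)
qed

lemma psi0_plus_upper:
  assumes "0 \<le> lam" "0 \<le> mu"
  shows "psi0_plus lam mu (E + H) \<le> psi0_plus lam mu E + stress_plus lam mu E \<bullet> H + elastic_energy lam mu H"
proof -
  have max: "(max 0 (x + y))\<^sup>2 \<le> (max 0 x)\<^sup>2 + 2 * (max 0 x * y) + y\<^sup>2" for x y :: real
  proof (cases "x \<le> 0")
    case True
    then have "(max 0 (x + y))\<^sup>2 \<le> \<bar>y\<bar>\<^sup>2" by (intro power_mono) auto
    with True show ?thesis by simp
  next
    case False
    have "(max 0 (x + y))\<^sup>2 \<le> \<bar>x + y\<bar>\<^sup>2" by (intro power_mono) auto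
    with False show ?thesis by (simp add: power2_sum)
  qed
  have "lam / 2 * (max 0 ((E + H) \<bullet> identity))\<^sup>2
      \<le> lam / 2 * ((max 0 (E \<bullet> identity))\<^sup>2 + 2 * (max 0 (E \<bullet> identity) * (H \<bullet> identity)) + (H \<bullet> identity)\<^sup>2)"
    using assms(1) max[of "E \<bullet> identity" "H \<bullet> identity"] by (intro mult_left_mono) (simp_all add: inner_add_left)
  moreover have "mu * (norm (pos_part (E + H)))\<^sup>2 \<le> mu * ((norm (pos_part E))\<^sup>2 + 2 * (pos_part E \<bullet> H) + (norm H)\<^sup>2)"
    using assms(2) norm_pos_part_sq_upper[of E H] by (intro mult_left_mono)
  ultimately show ?thesis
    by (simp add: psi0_plus_eq stress_plus_def elastic_energy_def inner_commute[of _ H] inner_add_right algebra_simps)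
qed

text \<open>
One constant for the Lipschitz estimate of the gradient and for the quadratic upper bound of the
energy; the squared norm of the identity matrix, its trace, enters through Cauchy-Schwarz.
\<close>

definition stress_bound :: "'n::finite itself \<Rightarrow> real \<Rightarrow> real \<Rightarrow> real" where
  "stress_bound _ lam mu = lam * (norm (identity :: 'n symmat))\<^sup>2 + 2 * mu"

lemma elastic_energy_le:
  assumes "0 \<le> lam" "0 \<le> mu"
  shows "elastic_energy lam mu (H :: 'n::finite symmat) \<le> stress_bound TYPE('n) lam mu * (norm H)\<^sup>2"
proof -
  have "(H \<bullet> identity)\<^sup>2 \<le> (norm (identity :: 'n symmat))\<^sup>2 * (norm H)\<^sup>2"
    using Cauchy_Schwarz_ineq[of H identity] by (simp add: power2_norm_eq_inner mult.commute)
  then have "lam / 2 * (H \<bullet> identity)\<^sup>2 \<le> lam * ((norm (identity :: 'n symmat))\<^sup>2 * (norm H)\<^sup>2)"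
    using assms(1) by (intro mult_mono) auto
  moreover have "mu * (norm H)\<^sup>2 \<le> 2 * mu * (norm H)\<^sup>2" using assms(2) by simp
  ultimately show ?thesis unfolding elastic_energy_def stress_bound_def by (simp add: algebra_simps)
qed

lemma stress_plus_Lipschitz:
  fixes A B :: "'n::finite symmat"
  assumes "0 \<le> lam" "0 \<le> mu"
  shows "norm (stress_plus lam mu A - stress_plus lam mu B) \<le> stress_bound TYPE('n) lam mu * norm (A - B)"
proof -
  let ?I = "identity :: 'n symmat"
  have "\<bar>max 0 (A \<bullet> ?I) - max 0 (B \<bullet> ?I)\<bar> \<le> \<bar>(A - B) \<bullet> ?I\<bar>"
    by (simp add: inner_diff_left max_def)
  also have "\<dots> \<le> norm (A - B) * norm ?I" by (rule Cauchy_Schwarz_ineq2)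
  finally have *: "\<bar>max 0 (A \<bullet> ?I) - max 0 (B \<bullet> ?I)\<bar> * norm ?I \<le> norm (A - B) * norm ?I * norm ?I"
    by (intro mult_right_mono) auto
  have "norm (stress_plus lam mu A - stress_plus lam mu B)
      = norm ((lam * (max 0 (A \<bullet> ?I) - max 0 (B \<bullet> ?I))) *\<^sub>R ?I + (2 * mu) *\<^sub>R (pos_part A - pos_part B))"
    by (simp add: stress_plus_def algebra_simps)
  also have "\<dots> \<le> lam * (\<bar>max 0 (A \<bullet> ?I) - max 0 (B \<bullet> ?I)\<bar> * norm ?I) + 2 * mu * norm (pos_part A - pos_part B)"
    using assms by (intro norm_triangle_le) (simp add: abs_mult)
  also have "\<dots> \<le> lam * (norm (A - B) * norm ?I * norm ?I) + 2 * mu * norm (A - B)"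
    using assms by (intro add_mono mult_left_mono * pos_part_nonexpansive) auto
  finally show ?thesis by (simp add: stress_bound_def power2_eq_square algebra_simps)
qed

text \<open>
The gradient of $E \mapsto a\,\Phi(E) + b\,\Phi(-E)$ for \<open>\<Phi> = psi0_plus lam mu\<close>.
\<close>

definition stress :: "real \<Rightarrow> real \<Rightarrow> real \<Rightarrow> real \<Rightarrow> 'n::finite symmat \<Rightarrow> 'n symmat" where
  "stress lam mu a b E = a *\<^sub>R stress_plus lam mu E - b *\<^sub>R stress_plus lam mu (- E)"

text \<open>
The nonlinear part of the gradient carries the factor \<open>b - a\<close>; all failures of smoothness are
therefore those of \<open>stress_plus\<close>, and there are none if \<open>a = b\<close>.
\<close>

lemma stress_eq: "stress lam mu a b E = b *\<^sub>R elastic_stress lam mu E - (b - a) *\<^sub>R stress_plus lam mu E"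
  by (simp add: stress_def algebra_simps flip: stress_plus_split)

lemma GDERIV_quadratic_sandwich:
  fixes f :: "'a::real_inner \<Rightarrow> real"
  assumes "\<And>H. f x + D \<bullet> H \<le> f (x + H)" "\<And>H. f (x + H) \<le> f x + D \<bullet> H + C * (norm H)\<^sup>2"
  shows "GDERIV f x :> D"
  unfolding gderiv_def
proof (rule has_derivativeI_sandwich[of 1])
  show "norm (f y - f x - (y - x) \<bullet> D) / norm (y - x) \<le> C * norm (y - x)" if "y \<noteq> x" for y
    using assms[of "y - x"] that by (simp add: inner_commute divide_simps power2_eq_square)
  have "((\<lambda>y. C * norm (y - x)) \<longlongrightarrow> C * norm (x - x)) (at x)" by (intro tendsto_intros)
  then show "((\<lambda>y. C * norm (y - x)) \<longlongrightarrow> 0) (at x)" by simp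
qed (auto intro: bounded_linear_inner_left)

lemma GDERIV_energy:
  fixes E :: "'n::finite symmat"
  assumes "0 \<le> lam" "0 \<le> mu" "0 \<le> a" "0 \<le> b"
  shows "GDERIV (\<lambda>E. a * psi0_plus lam mu E + b * psi0_plus lam mu (- E)) E :> stress lam mu a b E"
proof (rule GDERIV_quadratic_sandwich)
  fix H :: "'n symmat"
  let ?c = "stress_bound TYPE('n) lam mu"
  have "a * (psi0_plus lam mu E + stress_plus lam mu E \<bullet> H) \<le> a * psi0_plus lam mu (E + H)"
    "b * (psi0_plus lam mu (- E) + stress_plus lam mu (- E) \<bullet> (- H)) \<le> b * psi0_plus lam mu (- E + - H)"
    by (intro mult_left_mono psi0_plus_lower assms)+
  then show "a * psi0_plus lam mu E + b * psi0_plus lam mu (- E) + stress lam mu a b E \<bullet> H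
      \<le> a * psi0_plus lam mu (E + H) + b * psi0_plus lam mu (- (E + H))"
    by (simp add: stress_def inner_diff_left algebra_simps)
  have up: "psi0_plus lam mu (E + H) \<le> psi0_plus lam mu E + stress_plus lam mu E \<bullet> H + ?c * (norm H)\<^sup>2"
    for E H :: "'n symmat"
    using psi0_plus_upper[OF assms(1,2), of E H] elastic_energy_le[OF assms(1,2), of H] by linarith
  have "a * psi0_plus lam mu (E + H) \<le> a * (psi0_plus lam mu E + stress_plus lam mu E \<bullet> H + ?c * (norm H)\<^sup>2)"
    "b * psi0_plus lam mu (- E + - H) \<le> b * (psi0_plus lam mu (- E) + stress_plus lam mu (- E) \<bullet> (- H) + ?c * (norm (- H))\<^sup>2)"
    by (intro mult_left_mono up assms)+
  then show "a * psi0_plus lam mu (E + H) + b * psi0_plus lam mu (- (E + H))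
    \<le> a * psi0_plus lam mu E + b * psi0_plus lam mu (- E) + stress lam mu a b E \<bullet> H + ((a + b) * ?c) * (norm H)\<^sup>2"
    by (simp add: stress_def inner_diff_left algebra_simps)
qed

lemma gradient_eqI: "GDERIV f x :> D \<Longrightarrow> gradient f x = D"
  unfolding gradient_def
proof (rule the_equality)
  fix D' assume "GDERIV f x :> D" "GDERIV f x :> D'"
  then have "(\<lambda>h. h \<bullet> D') = (\<lambda>h. h \<bullet> D)" unfolding gderiv_def by (metis has_derivative_unique)
  then have "(D' - D) \<bullet> D' = (D' - D) \<bullet> D" by metis
  then have "(D' - D) \<bullet> (D' - D) = 0" by (simp add: inner_diff_right)
  then show "D' = D" by simp
qed

lemma stress_Lipschitz:
  fixes A B :: "'n::finite symmat"
  assumes "0 \<le> lam" "0 \<le> mu" "0 \<le> a" "0 \<le> b"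
  shows "norm (stress lam mu a b A - stress lam mu a b B) \<le> (a + b) * stress_bound TYPE('n) lam mu * norm (A - B)"
proof -
  have "norm (stress lam mu a b A - stress lam mu a b B)
    = norm (a *\<^sub>R (stress_plus lam mu A - stress_plus lam mu B)
        + b *\<^sub>R (stress_plus lam mu (- B) - stress_plus lam mu (- A)))"
    by (simp add: stress_def algebra_simps)
  also have "\<dots> \<le> a * norm (stress_plus lam mu A - stress_plus lam mu B)
        + b * norm (stress_plus lam mu (- B) - stress_plus lam mu (- A))"
    using assms by (intro norm_triangle_le) simp
  also have "\<dots> \<le> a * (stress_bound TYPE('n) lam mu * norm (A - B)) + b * (stress_bound TYPE('n) lam mu * norm (- B - - A))"
    using assms by (intro add_mono mult_left_mono stress_plus_Lipschitz)
  finally show ?thesis by (simp add: algebra_simps)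
qed

lemma psi0_plus_convex:
  assumes "0 \<le> lam" "0 \<le> mu" "0 \<le> t" "t \<le> 1"
  shows "psi0_plus lam mu (t *\<^sub>R A + (1 - t) *\<^sub>R B) \<le> t * psi0_plus lam mu A + (1 - t) * psi0_plus lam mu B"
proof -
  define C where "C = t *\<^sub>R A + (1 - t) *\<^sub>R B"
  define S where "S = stress_plus lam mu C"
  have "psi0_plus lam mu C + S \<bullet> (X - C) \<le> psi0_plus lam mu X" for X
    using psi0_plus_lower[OF assms(1,2), of C "X - C"] by (simp add: S_def)
  then have "t * (psi0_plus lam mu C + S \<bullet> (A - C)) + (1 - t) * (psi0_plus lam mu C + S \<bullet> (B - C))
      \<le> t * psi0_plus lam mu A + (1 - t) * psi0_plus lam mu B"
    using assms by (intro add_mono mult_left_mono) auto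
  moreover have "t * (S \<bullet> (A - C)) + (1 - t) * (S \<bullet> (B - C)) = S \<bullet> (t *\<^sub>R (A - C) + (1 - t) *\<^sub>R (B - C))"
    by (simp add: inner_add_right)
  moreover have "t *\<^sub>R (A - C) + (1 - t) *\<^sub>R (B - C) = 0" by (simp add: C_def algebra_simps)
  moreover have "t * (p + x) + (1 - t) * (p + y) = p + (t * x + (1 - t) * y)" for p x y :: real
    by (simp add: algebra_simps)
  ultimately show ?thesis by (simp add: C_def[symmetric])
qed

lemma elastic_energy_strongly_convex:
  assumes "0 \<le> lam" "0 \<le> t" "t \<le> 1"
  shows "elastic_energy lam mu (t *\<^sub>R A + (1 - t) *\<^sub>R B)
    \<le> t * elastic_energy lam mu A + (1 - t) * elastic_energy lam mu B - mu * (t * (1 - t) * (norm (A - B))\<^sup>2)"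
proof -
  have "lam / 2 * (t * (1 - t) * ((A - B) \<bullet> identity)\<^sup>2) \<ge> 0" using assms by simp
  moreover have "elastic_energy lam mu (t *\<^sub>R A + (1 - t) *\<^sub>R B)
    = t * elastic_energy lam mu A + (1 - t) * elastic_energy lam mu B - mu * (t * (1 - t) * (norm (A - B))\<^sup>2)
      - lam / 2 * (t * (1 - t) * ((A - B) \<bullet> identity)\<^sup>2)"
    unfolding elastic_energy_def power2_norm_eq_inner
    by (simp add: inner_add_left inner_add_right inner_diff_left inner_diff_right inner_commute power2_eq_square)
      (simp add: field_simps inner_commute)
  ultimately show ?thesis by linarith
qed

text \<open>
For \<open>0 < a \<le> b\<close>, \<open>lam \<ge> 0\<close> and \<open>mu > 0\<close> the right hand side is a strongly convex quadratic form plus a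
convex nonnegative function.
\<close>

lemma energy_split: "a * psi0_plus lam mu E + b * psi0_plus lam mu (- E)
    = a * elastic_energy lam mu E + (b - a) * psi0_plus lam mu (- E)"
  by (simp add: algebra_simps flip: psi0_plus_split)

lemma energy_strongly_convex:
  assumes pos: "0 \<le> lam" "0 \<le> mu" "0 \<le> t" "t \<le> 1" "0 \<le> k" "k \<le> a" "a \<le> b"
  defines "f \<equiv> \<lambda>E. a * psi0_plus lam mu E + b * psi0_plus lam mu (- E)"
  shows "f (t *\<^sub>R A + (1 - t) *\<^sub>R B) \<le> t * f A + (1 - t) * f B - k * mu * (t * (1 - t) * (norm (A - B))\<^sup>2)"
proof -
  have "a * elastic_energy lam mu (t *\<^sub>R A + (1 - t) *\<^sub>R B) \<le> a * (t * elastic_energy lam mu A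
      + (1 - t) * elastic_energy lam mu B - mu * (t * (1 - t) * (norm (A - B))\<^sup>2))"
    using pos by (intro mult_left_mono elastic_energy_strongly_convex) auto
  moreover have "(b - a) * psi0_plus lam mu (t *\<^sub>R (- A) + (1 - t) *\<^sub>R (- B))
      \<le> (b - a) * (t * psi0_plus lam mu (- A) + (1 - t) * psi0_plus lam mu (- B))"
    using pos by (intro mult_left_mono psi0_plus_convex) auto
  moreover have "- (t *\<^sub>R A + (1 - t) *\<^sub>R B) = t *\<^sub>R (- A) + (1 - t) *\<^sub>R (- B)" by simp
  moreover have "k * (mu * (t * (1 - t) * (norm (A - B))\<^sup>2)) \<le> a * (mu * (t * (1 - t) * (norm (A - B))\<^sup>2))"
    using pos by (intro mult_right_mono) auto
  ultimately show ?thesis unfolding f_def energy_split by (simp add: algebra_simps)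
qed

lemma energy_coercive:
  assumes "0 \<le> lam" "0 \<le> mu" "0 \<le> k" "k \<le> a" "a \<le> b"
  shows "k * mu * (norm E)\<^sup>2 \<le> a * psi0_plus lam mu E + b * psi0_plus lam mu (- E)"
proof -
  have "k * (mu * (norm E)\<^sup>2) \<le> a * elastic_energy lam mu E"
    using assms by (intro mult_mono) (auto simp: elastic_energy_def)
  moreover have "0 \<le> (b - a) * psi0_plus lam mu (- E)" using assms by (simp add: psi0_plus_nonneg)
  ultimately show ?thesis by (simp add: energy_split)
qed

section \<open>Kinks of the gradient\<close>

text \<open>
At a point of differentiability the symmetric second difference is $o(s)$.
\<close>

lemma not_differentiable_convex_kink:
  fixes f :: "real \<Rightarrow> real"
  assumes c: "0 < c" and kink: "\<And>s. 0 < s \<Longrightarrow> c * s \<le> f s + f (- s) - 2 * f 0"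
  shows "\<not> (f has_derivative D) (at 0)"
proof
  assume D: "(f has_derivative D) (at 0)"
  then have "\<forall>e>0. \<exists>d>0. \<forall>y. norm (y - 0) < d \<longrightarrow> norm (f y - f 0 - D (y - 0)) \<le> e * norm (y - 0)"
    unfolding has_derivative_at_alt by blast
  from this[rule_format, of "c / 4"] c
  obtain d where d: "0 < d" "\<And>y. \<bar>y\<bar> < d \<Longrightarrow> \<bar>f y - f 0 - D y\<bar> \<le> c / 4 * \<bar>y\<bar>"
    by (auto simp: real_norm_def)
  have "D (- (d / 2)) = - D (d / 2)"
    using D by (simp add: has_derivative_bounded_linear linear_neg bounded_linear.linear)
  moreover have "\<bar>f (d / 2) - f 0 - D (d / 2)\<bar> \<le> c / 4 * (d / 2)"
    using d(2)[of "d / 2"] d(1) by simp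
  moreover have "\<bar>f (- (d / 2)) - f 0 - D (- (d / 2))\<bar> \<le> c / 4 * (d / 2)"
    using d(2)[of "- (d / 2)"] d(1) by simp
  moreover have "c * (d / 2) \<le> f (d / 2) + f (- (d / 2)) - 2 * f 0" using kink[of "d / 2"] d(1) by simp
  moreover have "0 < c * (d / 2)" using c d(1) by simp
  ultimately show False by linarith
qed

lemma has_derivative_along_line:
  assumes D: "(F has_derivative D) (at B)"
  shows "((\<lambda>s. F (B + s *\<^sub>R H) \<bullet> C) has_derivative (\<lambda>s. D (s *\<^sub>R H) \<bullet> C)) (at 0)"
proof -
  have "((\<lambda>s. B + s *\<^sub>R H) has_derivative (\<lambda>s. s *\<^sub>R H)) (at 0)"
    by (auto intro!: derivative_eq_intros)
  from has_derivative_compose[OF this, of F D] D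
  have "((\<lambda>s. F (B + s *\<^sub>R H)) has_derivative (\<lambda>s. D (s *\<^sub>R H))) (at 0)" by simp
  then show ?thesis by (rule has_derivative_inner_left)
qed

text \<open>
Perturb along \<open>outer u\<close> for a unit vector \<open>u\<close> in the kernel of \<open>B\<close>. The entry
$\langle u, (B + s\,uu^T)_+ u\rangle$ is at least $\max(0,s)$ because $X \ge 0$ and $X \ge E$ for
$X = E_+$, and it vanishes at $s = 0$. The trace term is convex in $s$ and cannot cancel this kink.
\<close>

lemma stress_plus_differentiable_imp_invertible:
  assumes lam: "0 \<le> lam" and mu: "0 < mu" and D: "(stress_plus lam mu has_derivative D) (at B)"
    and ker: "act B v = 0"
  shows "v = 0"
proof (rule ccontr)
  assume "v \<noteq> 0"
  define u where "u = v /\<^sub>R norm v"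
  have "norm u = 1" using \<open>v \<noteq> 0\<close> by (simp add: u_def)
  then have u: "u \<bullet> u = 1" "act B u = 0" using ker by (simp add: norm_eq_1) (simp add: u_def ker)
  define f where "f s = stress_plus lam mu (B + s *\<^sub>R outer u) \<bullet> outer u" for s
  have tr: "identity \<bullet> outer u = 1" "outer u \<bullet> identity = 1"
    using u by (simp_all add: inner_outer inner_commute[of _ identity])
  have f: "f s = lam * max 0 (B \<bullet> identity + s) + 2 * mu * (u \<bullet> act (pos_part (B + s *\<^sub>R outer u)) u)" for s
    by (simp add: f_def stress_plus_def inner_add_left inner_add_right tr inner_outer u)
  have lb: "max 0 s \<le> u \<bullet> act (pos_part (B + s *\<^sub>R outer u)) u" for s
  proof -
    let ?E = "B + s *\<^sub>R outer u"
    have "0 \<le> u \<bullet> act (pos_part ?E) u" "0 \<le> u \<bullet> act (pos_part ?E - ?E) u"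
      using psd_pos_part[of ?E] unfolding psd_def by blast+
    then show ?thesis using u by (simp add: inner_diff_right)
  qed
  have "2 * mu * s \<le> f s + f (- s) - 2 * f 0" if "0 < s" for s
  proof -
    have "mu * s \<le> mu * (u \<bullet> act (pos_part (B + s *\<^sub>R outer u)) u)"
      "0 \<le> mu * (u \<bullet> act (pos_part (B + (- s) *\<^sub>R outer u)) u)"
      using lb[of s] lb[of "- s"] mu by (auto intro: mult_left_mono mult_nonneg_nonneg)
    moreover have "lam * (max 0 (B \<bullet> identity + s) + max 0 (B \<bullet> identity - s)) \<ge> lam * (2 * max 0 (B \<bullet> identity))"
      using lam by (intro mult_left_mono) auto
    ultimately show ?thesis unfolding f using pos_part_kernel[OF u(2)] by (simp add: algebra_simps)
  qed
  then have "\<not> (f has_derivative (\<lambda>s. D (s *\<^sub>R outer u) \<bullet> outer u)) (at 0)"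
    using mu by (intro not_differentiable_convex_kink[of "2 * mu"]) auto
  then show False using has_derivative_along_line[OF D] unfolding f_def by blast
qed

text \<open>
Perturb along the identity. Here the kink comes from the trace term, and the trace of
$(B + sI)_+$, which is $\sum_i \max(0, b_i + s)$, is convex in $s$, so that it cannot cancel the kink
either.
\<close>

lemma stress_plus_differentiable_imp_trace:
  fixes B :: "'n::finite symmat"
  assumes lam: "0 < lam" and mu: "0 \<le> mu" and D: "(stress_plus lam mu has_derivative D) (at B)"
  shows "B \<bullet> identity \<noteq> 0"
proof
  assume tr: "B \<bullet> identity = 0"
  define m where "m = (identity :: 'n symmat) \<bullet> identity"
  have m: "m = real CARD('n)" unfolding m_def
    using norm_orthonormal[OF orthonormal_axis] by (simp add: trace_orthonormal[OF orthonormal_axis] norm_eq_1)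
  define f where "f s = stress_plus lam mu (B + s *\<^sub>R identity) \<bullet> identity" for s
  obtain q b where q: "orthonormal q" and b: "\<And>i. act B (q i) = b i *\<^sub>R q i"
    using spectral_basis[of B] by blast
  have qq: "q i \<bullet> q i = 1" for i using q by (simp add: orthonormal_def)
  define P where "P s = pos_part (B + s *\<^sub>R identity) \<bullet> identity" for s
  have lb: "(\<Sum>i\<in>UNIV. max 0 (b i + s)) \<le> P s" for s
    unfolding P_def trace_orthonormal[OF q]
  proof (rule sum_mono)
    fix i
    let ?E = "B + s *\<^sub>R identity"
    have "0 \<le> q i \<bullet> act (pos_part ?E) (q i)" "0 \<le> q i \<bullet> act (pos_part ?E - ?E) (q i)"
      using psd_pos_part[of ?E] unfolding psd_def by blast+
    then show "max 0 (b i + s) \<le> q i \<bullet> act (pos_part ?E) (q i)" using b qq by (simp add: inner_add_right inner_diff_right)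
  qed
  have P0: "P 0 = (\<Sum>i\<in>UNIV. max 0 (b i))"
    using qq by (simp add: P_def trace_orthonormal[OF q] act_pos_part[OF q b])
  have "lam * m * m * s \<le> f s + f (- s) - 2 * f 0" if "0 < s" for s
  proof -
    have "2 * P 0 \<le> (\<Sum>i\<in>UNIV. max 0 (b i + s) + max 0 (b i + - s))"
      unfolding P0 sum_distrib_left by (intro sum_mono) auto
    also have "\<dots> \<le> P s + P (- s)" unfolding sum.distrib by (intro add_mono lb)
    finally have "mu * (2 * P 0) \<le> mu * (P s + P (- s))" using mu by (intro mult_left_mono)
    moreover have "f s = lam * max 0 (s * m) * m + 2 * mu * P s" for s
      by (simp add: f_def P_def stress_plus_def inner_add_left tr m_def)
    moreover have "max 0 (s * m) = s * m" "max 0 (- s * m) = 0" using m that by auto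
    ultimately show ?thesis by (simp add: algebra_simps)
  qed
  moreover have "0 < lam * m * m" using lam m by simp
  ultimately have "\<not> (f has_derivative (\<lambda>s. D (s *\<^sub>R identity) \<bullet> identity)) (at 0)"
    by (intro not_differentiable_convex_kink[of "lam * m * m"]) auto
  then show False using has_derivative_along_line[OF D] unfolding f_def by blast
qed

section \<open>Derivatives of the positive part\<close>

lemma bounded_linear_act: "bounded_linear (\<lambda>X. act X v)"
  by (rule bounded_linear_intro[of _ "norm v"]) (simp_all add: norm_act_le)

text \<open>
Differentiating $E_+ (-E)_+ = 0$ at \<open>B\<close> in the direction \<open>H\<close> gives the Sylvester equation
$D(H)\,Y + X\,(D(H) - H) = 0$ with $X = B_+$ and $Y = (-B)_+$, which is diagonal in an eigenbasis of
\<open>B\<close>.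
\<close>

lemma pos_part_derivative_entry:
  assumes D: "(pos_part has_derivative D) (at B)"
    and q: "orthonormal q" and b: "\<And>i. act B (q i) = b i *\<^sub>R q i"
  shows "(max 0 (b i) + max 0 (- b j)) * (q i \<bullet> act (D H) (q j)) = max 0 (b i) * (q i \<bullet> act H (q j))"
proof -
  have b': "act (- B) (q i) = (- b i) *\<^sub>R q i" for i by (simp add: b)
  have D': "((\<lambda>E. pos_part E - E) has_derivative (\<lambda>H. D H - H)) (at B)"
    by (intro has_derivative_diff D has_derivative_ident)
  have "((\<lambda>E. act (pos_part E) (q i) \<bullet> act (pos_part E - E) (q j)) has_derivative
      (\<lambda>H. act (pos_part B) (q i) \<bullet> act (D H - H) (q j) + act (D H) (q i) \<bullet> act (pos_part B - B) (q j))) (at B)"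
    by (intro has_derivative_inner bounded_linear.has_derivative[OF bounded_linear_act] D D')
  moreover have "act (pos_part E) (q i) \<bullet> act (pos_part E - E) (q j) = 0" for E
    using pos_part_orthogonal[of E "q i" "q j"] unfolding pos_part_minus .
  ultimately have "((\<lambda>E. 0) has_derivative (\<lambda>H. act (pos_part B) (q i) \<bullet> act (D H - H) (q j)
      + act (D H) (q i) \<bullet> act (pos_part B - B) (q j))) (at B)" by (simp only:)
  from has_derivative_unique[OF this has_derivative_const]
  have "act (pos_part B) (q i) \<bullet> act (D H - H) (q j) + act (D H) (q i) \<bullet> act (pos_part B - B) (q j) = 0"
    by (rule fun_cong)
  moreover have "act (D H) (q i) \<bullet> q j = q i \<bullet> act (D H) (q j)" by (rule act_self_adjoint)
  ultimately show ?thesis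
    using act_pos_part[OF q b', of j]
    by (simp add: pos_part_minus act_pos_part[OF q b] inner_diff_right algebra_simps del: act_simps(7))
       (simp add: inner_diff_right algebra_simps)
qed

lemma entry_symmetric: "q i \<bullet> act A (q j) = q j \<bullet> act A (q i)"
  by (metis act_self_adjoint inner_commute)

lemma pos_neg_abs: "max 0 x + max 0 (- x) = \<bar>x\<bar>" for x :: real
  by simp

lemma scaled_abs_eq: "0 \<le> x \<Longrightarrow> x * e = z \<Longrightarrow> x * \<bar>e\<bar> = \<bar>z\<bar>" for x e z :: real
  by (auto simp: abs_mult)

text \<open>
Adding the entry equation and its transpose gives
$(|b_i| + |b_j|)\,D(H)_{ij} = (\max(0,b_i) + \max(0,b_j))\,H_{ij}$, so the derivative multiplies the
entries by factors in $[0,1]$. No eigenvalue vanishes, so the factors are well defined.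
\<close>

lemma pos_part_derivative_entry_le:
  assumes D: "(pos_part has_derivative D) (at B)" and inv: "\<And>v. act B v = 0 \<Longrightarrow> v = 0"
    and q: "orthonormal q" and b: "\<And>i. act B (q i) = b i *\<^sub>R q i"
  shows "\<bar>q i \<bullet> act (D H) (q j)\<bar> \<le> \<bar>q i \<bullet> act H (q j)\<bar>"
proof -
  let ?d = "q i \<bullet> act (D H) (q j)" and ?h = "q i \<bullet> act H (q j)"
  have "b i \<noteq> 0" using b[of i] inv[of "q i"] norm_orthonormal[OF q, of i] by auto
  have "(max 0 (b i) + max 0 (- b j)) * ?d = max 0 (b i) * ?h"
    "(max 0 (b j) + max 0 (- b i)) * ?d = max 0 (b j) * ?h"
    using pos_part_derivative_entry[OF D q b, of i j H] pos_part_derivative_entry[OF D q b, of j i H]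
    by (simp_all add: entry_symmetric[of q j _ i])
  then have "(\<bar>b i\<bar> + \<bar>b j\<bar>) * ?d = (max 0 (b i) + max 0 (b j)) * ?h"
    unfolding pos_neg_abs[symmetric] by (simp add: algebra_simps)
  then have "(\<bar>b i\<bar> + \<bar>b j\<bar>) * \<bar>?d\<bar> = (max 0 (b i) + max 0 (b j)) * \<bar>?h\<bar>"
    using scaled_abs_eq[of "\<bar>b i\<bar> + \<bar>b j\<bar>" ?d] by (simp add: abs_mult)
  also have "\<dots> \<le> (\<bar>b i\<bar> + \<bar>b j\<bar>) * \<bar>?h\<bar>" by (intro mult_right_mono) auto
  finally show ?thesis using \<open>b i \<noteq> 0\<close> by (simp add: mult_le_cancel_left add_pos_nonneg)
qed

text \<open>
The key estimate. Write $X, Y$ for $B_+, (-B)_+$ and $X_0, Y_0$ for $A_+, (-A)_+$. Inserting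
$H = A = X_0 - Y_0$ into the Sylvester equation, the error $D(A) - X_0$ solves the same equation with right
hand side $-(X Y_0 + X_0 Y)$, and by $XY = X_0 Y_0 = 0$ this equals $(X - X_0)(Y - Y_0)$, a
product of two terms of order $|B - A|$.
\<close>

lemma pos_part_secant_entry:
  assumes D: "(pos_part has_derivative D) (at B)"
    and q: "orthonormal q" and b: "\<And>i. act B (q i) = b i *\<^sub>R q i"
  shows "(\<bar>b i\<bar> + \<bar>b j\<bar>) * \<bar>q i \<bullet> act (D A - pos_part A) (q j)\<bar> \<le> 2 * (norm (B - A))\<^sup>2"
proof -
  let ?e = "\<lambda>i j. q i \<bullet> act (D A - pos_part A) (q j)"
  have b': "act (- B) (q i) = (- b i) *\<^sub>R q i" for i by (simp add: b)
  have half: "(max 0 (b i) + max 0 (- b j)) * \<bar>?e i j\<bar> \<le> (norm (B - A))\<^sup>2" for i j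
  proof -
    let ?X = "pos_part B - pos_part A" and ?Y = "pos_part (- B) - pos_part (- A)"
    have "(max 0 (b i) + max 0 (- b j)) * ?e i j
        = max 0 (b i) * (q i \<bullet> act A (q j)) - (max 0 (b i) + max 0 (- b j)) * (q i \<bullet> act (pos_part A) (q j))"
      using pos_part_derivative_entry[OF D q b, of i j A] by (simp add: inner_diff_right algebra_simps)
    also have "\<dots> = - (act (pos_part B) (q i) \<bullet> act (pos_part (- A)) (q j))
        - act (pos_part A) (q i) \<bullet> act (pos_part (- B)) (q j)"
      unfolding act_pos_part[OF q b] act_pos_part[OF q b'] act_self_adjoint[of "pos_part A"]
      by (simp add: act_self_adjoint pos_part_minus inner_diff_right algebra_simps)
    also have "\<dots> = act ?X (q i) \<bullet> act ?Y (q j)"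
      by (simp add: inner_diff_left inner_diff_right pos_part_orthogonal)
    finally have "(max 0 (b i) + max 0 (- b j)) * ?e i j = act ?X (q i) \<bullet> act ?Y (q j)" .
    then have "(max 0 (b i) + max 0 (- b j)) * \<bar>?e i j\<bar> = \<bar>act ?X (q i) \<bullet> act ?Y (q j)\<bar>"
      by (intro scaled_abs_eq) auto
    also have "\<dots> \<le> norm (act ?X (q i)) * norm (act ?Y (q j))" by (rule Cauchy_Schwarz_ineq2)
    also have "\<dots> \<le> norm (B - A) * norm (B - A)"
    proof (intro mult_mono)
      show "norm (act ?X (q i)) \<le> norm (B - A)"
        using norm_act_le[of ?X "q i"] pos_part_nonexpansive[of B A] by (simp add: norm_orthonormal[OF q])
      show "norm (act ?Y (q j)) \<le> norm (B - A)"
        using norm_act_le[of ?Y "q j"] pos_part_nonexpansive[of "- B" "- A"]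
        by (simp add: norm_orthonormal[OF q] norm_minus_commute)
    qed auto
    finally show ?thesis by (simp add: power2_eq_square)
  qed
  have "(\<bar>b i\<bar> + \<bar>b j\<bar>) * \<bar>?e i j\<bar>
      = (max 0 (b i) + max 0 (- b j)) * \<bar>?e i j\<bar> + (max 0 (b j) + max 0 (- b i)) * \<bar>?e j i\<bar>"
    unfolding pos_neg_abs[symmetric] entry_symmetric[of q j _ i] by (simp add: algebra_simps)
  then show ?thesis using half[of i j] half[of j i] by linarith
qed

text \<open>
Euler's identity for the positively homogeneous positive part; it is the case \<open>A = B\<close> of the secant
estimate.
\<close>

lemma pos_part_Euler:
  assumes D: "(pos_part has_derivative D) (at B)" and inv: "\<And>v. act B v = 0 \<Longrightarrow> v = 0"
  shows "D B = pos_part B"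
proof -
  obtain q b where q: "orthonormal q" and b: "\<And>i. act B (q i) = b i *\<^sub>R q i"
    using spectral_basis[of B] by blast
  have "\<bar>q i \<bullet> act (D B - pos_part B) (q j)\<bar> = 0" for i j
  proof -
    have "b i \<noteq> 0" using b[of i] inv[of "q i"] norm_orthonormal[OF q, of i] by auto
    moreover have "(\<bar>b i\<bar> + \<bar>b j\<bar>) * \<bar>q i \<bullet> act (D B - pos_part B) (q j)\<bar> \<le> 0"
      using pos_part_secant_entry[OF D q b, of i j B] by simp
    ultimately show ?thesis by (smt (verit) mult_pos_pos)
  qed
  then have "norm (D B - pos_part B) \<le> 0"
    using norm_symmat_le_sum_entries[OF q, of "D B - pos_part B"] by (simp only: sum.neutral_const)
  then show ?thesis by simp
qed

text \<open>
An eigenvector \<open>q k\<close> of \<open>B\<close> with a small eigenvalue is nearly in the kernel of \<open>A\<close>: its component along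
an eigenvector \<open>p l\<close> of \<open>A\<close> satisfies $(a_l - b_k)\langle q_k, p_l\rangle = -\langle q_k, (B-A)p_l\rangle$,
where $|a_l - b_k| \ge c/2$ as soon as $a_l \ne 0$. An entry of \<open>M\<close> between two such vectors contains two
such components and is of second order. The lemma is used for \<open>M = A\<close> and for \<open>M = pos_part A\<close>.
\<close>

lemma small_eigenvector_entry_le:
  assumes q: "orthonormal q" and b: "\<And>i. act B (q i) = b i *\<^sub>R q i"
    and p: "orthonormal p" and a: "\<And>l. act A (p l) = a l *\<^sub>R p l"
    and M: "\<And>l. act M (p l) = m l *\<^sub>R p l" "\<And>l. \<bar>m l\<bar> \<le> \<bar>a l\<bar>"
    and c: "0 < c" "\<And>l. a l \<noteq> 0 \<Longrightarrow> c \<le> \<bar>a l\<bar>" and small: "\<bar>b i\<bar> < c / 2" "\<bar>b j\<bar> < c / 2"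
  shows "\<bar>q i \<bullet> act M (q j)\<bar> \<le> (\<Sum>l\<in>UNIV. \<bar>a l\<bar>) * (2 / c * norm (B - A))\<^sup>2"
proof -
  have comp: "\<bar>q k \<bullet> p l\<bar> \<le> 2 / c * norm (B - A)" if "\<bar>b k\<bar> < c / 2" "a l \<noteq> 0" for k l
  proof -
    have "(a l - b k) * (q k \<bullet> p l) = q k \<bullet> act A (p l) - act B (q k) \<bullet> p l"
      by (simp add: a b algebra_simps)
    also have "\<dots> = - (q k \<bullet> act (B - A) (p l))" by (simp add: act_self_adjoint inner_diff_right)
    finally have "\<bar>a l - b k\<bar> * \<bar>q k \<bullet> p l\<bar> \<le> norm (B - A)"
      using act_entry_le[OF q p, of k "B - A" l] by (metis abs_minus_cancel abs_mult)
    moreover have "c / 2 * \<bar>q k \<bullet> p l\<bar> \<le> \<bar>a l - b k\<bar> * \<bar>q k \<bullet> p l\<bar>"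
    proof (rule mult_right_mono)
      show "c / 2 \<le> \<bar>a l - b k\<bar>" using c(2)[OF that(2)] that(1) by linarith
    qed simp
    ultimately have "c / 2 * \<bar>q k \<bullet> p l\<bar> \<le> norm (B - A)" by linarith
    then show ?thesis using c(1) by (simp add: field_simps)
  qed
  have "q i \<bullet> act M (q j) = (\<Sum>l\<in>UNIV. (q i \<bullet> p l) * (act M (q j) \<bullet> p l))" by (rule Parseval[OF p])
  also have "\<dots> = (\<Sum>l\<in>UNIV. m l * ((q i \<bullet> p l) * (q j \<bullet> p l)))"
    by (simp add: act_self_adjoint M mult_ac)
  finally have "\<bar>q i \<bullet> act M (q j)\<bar> \<le> (\<Sum>l\<in>UNIV. \<bar>m l * ((q i \<bullet> p l) * (q j \<bullet> p l))\<bar>)" by simp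
  also have "\<dots> \<le> (\<Sum>l\<in>UNIV. \<bar>a l\<bar> * (2 / c * norm (B - A))\<^sup>2)"
  proof (rule sum_mono)
    fix l
    show "\<bar>m l * ((q i \<bullet> p l) * (q j \<bullet> p l))\<bar> \<le> \<bar>a l\<bar> * (2 / c * norm (B - A))\<^sup>2"
    proof (cases "a l = 0")
      case True
      then show ?thesis using M(2)[of l] by simp
    next
      case False
      then show ?thesis
        unfolding abs_mult power2_eq_square using small c(1) by (intro mult_mono M(2) comp) auto
    qed
  qed
  finally show ?thesis by (simp add: sum_distrib_right)
qed

text \<open>
In an eigenbasis of \<open>B\<close>, the entries of the error with a large $|b_i|$ or $|b_j|$ are controlled by
dividing the secant estimate by $|b_i| + |b_j|$. When both are small that division is not allowed, but
then \<open>D A\<close> and \<open>pos_part A\<close> have entries of second order individually.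
\<close>

lemma pos_part_strongly_semismooth:
  fixes A :: "'n::finite symmat"
  obtains C where "\<And>B D. (pos_part has_derivative D) (at B) \<Longrightarrow> (\<And>v. act B v = 0 \<Longrightarrow> v = 0)
    \<Longrightarrow> norm (D A - pos_part A) \<le> C * (norm (B - A))\<^sup>2"
proof -
  obtain p a where p: "orthonormal p" and a: "\<And>l. act A (p l) = a l *\<^sub>R p l"
    using spectral_basis[of A] by blast
  \<comment> \<open>The smallest nonzero modulus of an eigenvalue of \<open>A\<close>, capped at 1 to have a value for \<open>A = 0\<close>.\<close>
  define c where "c = Min (insert 1 ((\<lambda>l. \<bar>a l\<bar>) ` {l. a l \<noteq> 0}))"
  have c: "0 < c" "\<And>l. a l \<noteq> 0 \<Longrightarrow> c \<le> \<bar>a l\<bar>" by (auto simp: c_def)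
  define s where "s = (\<Sum>l\<in>UNIV. \<bar>a l\<bar>)"
  define K where "K = max (4 / c) (2 * s * (2 / c)\<^sup>2)"
  have "norm (D A - pos_part A) \<le> (real CARD('n) * real CARD('n) * K) * (norm (B - A))\<^sup>2"
    if D: "(pos_part has_derivative D) (at B)" and inv: "\<And>v. act B v = 0 \<Longrightarrow> v = 0" for B D
  proof -
    obtain q b where q: "orthonormal q" and b: "\<And>i. act B (q i) = b i *\<^sub>R q i"
      using spectral_basis[of B] by blast
    let ?e = "\<lambda>i j. \<bar>q i \<bullet> act (D A - pos_part A) (q j)\<bar>" and ?t = "(norm (B - A))\<^sup>2"
    have "?e i j \<le> K * ?t" for i j
    proof (cases "\<bar>b i\<bar> < c / 2 \<and> \<bar>b j\<bar> < c / 2")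
      case True
      have "?e i j \<le> \<bar>q i \<bullet> act (D A) (q j)\<bar> + \<bar>q i \<bullet> act (pos_part A) (q j)\<bar>"
        by (simp add: inner_diff_right)
      also have "\<dots> \<le> \<bar>q i \<bullet> act A (q j)\<bar> + \<bar>q i \<bullet> act (pos_part A) (q j)\<bar>"
        by (intro add_mono pos_part_derivative_entry_le[OF D inv q b] order_refl)
      also have "\<dots> \<le> s * (2 / c * norm (B - A))\<^sup>2 + s * (2 / c * norm (B - A))\<^sup>2"
        unfolding s_def using True
        by (intro add_mono small_eigenvector_entry_le[OF q b p a a _ c]
            small_eigenvector_entry_le[OF q b p a act_pos_part[OF p a] _ c]) auto
      also have "\<dots> = (2 * s * (2 / c)\<^sup>2) * ?t" by (simp add: power_mult_distrib power_divide)
      also have "\<dots> \<le> K * ?t" by (intro mult_right_mono) (auto simp: K_def)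
      finally show ?thesis .
    next
      case False
      then have "c / 2 \<le> \<bar>b i\<bar> + \<bar>b j\<bar>" by linarith
      then have "c / 2 * ?e i j \<le> (\<bar>b i\<bar> + \<bar>b j\<bar>) * ?e i j" by (intro mult_right_mono) auto
      also have "\<dots> \<le> 2 * ?t" by (rule pos_part_secant_entry[OF D q b])
      finally have "?e i j \<le> 4 / c * ?t" using c(1) by (simp add: field_simps)
      also have "\<dots> \<le> K * ?t" by (intro mult_right_mono) (auto simp: K_def)
      finally show ?thesis .
    qed
    then have "(\<Sum>i\<in>UNIV. \<Sum>j\<in>UNIV. ?e i j) \<le> (\<Sum>i\<in>(UNIV :: 'n set). \<Sum>j\<in>(UNIV :: 'n set). K * ?t)"
      by (intro sum_mono)
    then show ?thesis using norm_symmat_le_sum_entries[OF q, of "D A - pos_part A"] by (simp add: mult_ac)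
  qed
  then show thesis using that by blast
qed

section \<open>Directional derivatives of the positive part\<close>

text \<open>
Allows the directional derivative to be identified by algebraic relations that hold for every cluster
point, without an explicit formula for it.
\<close>

lemma tendsto_if_unique_cluster_point:
  fixes f :: "nat \<Rightarrow> 'a::heine_borel"
  assumes bd: "bounded (range f)"
    and uniq: "\<And>r l'. strict_mono (r :: nat \<Rightarrow> nat) \<Longrightarrow> (f \<circ> r) \<longlonglongrightarrow> l' \<Longrightarrow> l' = l"
  shows "f \<longlonglongrightarrow> l"
proof (rule ccontr)
  assume "\<not> f \<longlonglongrightarrow> l"
  then obtain e where e: "0 < e" "\<And>N. \<exists>n\<ge>N. e \<le> dist (f n) l"
    unfolding lim_sequentially by (meson not_less)
  then have "infinite {n. e \<le> dist (f n) l}"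
    unfolding infinite_nat_iff_unbounded_le by auto
  then obtain r :: "nat \<Rightarrow> nat" where r: "strict_mono r" "\<And>n. e \<le> dist (f (r n)) l"
    using infinite_enumerate by blast
  have "bounded (range (f \<circ> r))" by (rule bounded_subset[OF bd]) auto
  then obtain l' s where s: "strict_mono s" "(f \<circ> r \<circ> s) \<longlonglongrightarrow> l'"
    using bounded_imp_convergent_subsequence by metis
  then have "l' = l" using uniq[of "r \<circ> s" l'] r(1) by (simp add: strict_mono_o comp_assoc)
  then have "\<exists>n. dist ((f \<circ> r \<circ> s) n) l < e"
    using s(2) e(1) unfolding lim_sequentially by blast
  then show False using r(2) by (auto simp: not_less[symmetric])
qed

text \<open>
The limits of difference quotients along sequences that approach \<open>A\<close> in the direction \<open>V\<close>.
\<close>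

definition is_pos_part_slope :: "'n::finite symmat \<Rightarrow> 'n symmat \<Rightarrow> 'n symmat \<Rightarrow> bool" where
  "is_pos_part_slope A V h \<longleftrightarrow> (\<exists>W t. W \<longlonglongrightarrow> V \<and> (\<forall>n. 0 < t n) \<and> t \<longlonglongrightarrow> (0::real) \<and>
     (\<lambda>n. (pos_part (A + t n *\<^sub>R W n) - pos_part A) /\<^sub>R t n) \<longlonglongrightarrow> h)"

text \<open>
Put $H_n = ((A + t_n W_n)_+ - A_+)/t_n$, with limit \<open>h\<close>. By Moreau's decomposition the corresponding
quotients of $(-E)_+$ are $K_n = H_n - W_n$, with limit \<open>h - V\<close>. Expanding $E_+ (-E)_+ = 0$ at
$E = A + t_n W_n$ and dividing by $t_n$, or by $t_n^2$ where the first-order terms vanish, gives the two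
equations; the inequalities express that $A_+$ and $(-A)_+$ vanish on the kernel of \<open>A\<close>, so that the
quotients are semidefinite there.
\<close>

lemma pos_part_slope_properties:
  assumes "is_pos_part_slope A V h"
  shows "act (pos_part A) u \<bullet> act (h - V) v + act h u \<bullet> act (pos_part (- A)) v = 0"
    and "act (pos_part A) u = 0 \<Longrightarrow> act (pos_part (- A)) v = 0 \<Longrightarrow> act h u \<bullet> act (h - V) v = 0"
    and "act A u = 0 \<Longrightarrow> 0 \<le> u \<bullet> act h u"
    and "act A u = 0 \<Longrightarrow> 0 \<le> u \<bullet> act (h - V) u"
proof -
  obtain W t where W: "W \<longlonglongrightarrow> V" and t: "\<And>n. 0 < t n" "t \<longlonglongrightarrow> (0::real)"
    and h: "(\<lambda>n. (pos_part (A + t n *\<^sub>R W n) - pos_part A) /\<^sub>R t n) \<longlonglongrightarrow> h"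
    using assms unfolding is_pos_part_slope_def by blast
  define H where "H n = (pos_part (A + t n *\<^sub>R W n) - pos_part A) /\<^sub>R t n" for n
  define K where "K n = H n - W n" for n
  have X: "pos_part (A + t n *\<^sub>R W n) = pos_part A + t n *\<^sub>R H n" for n
    using t(1)[of n] by (simp add: H_def)
  have Y: "pos_part (- (A + t n *\<^sub>R W n)) = pos_part (- A) + t n *\<^sub>R K n" for n
    unfolding pos_part_minus X K_def by (simp add: algebra_simps)
  have act: "((\<lambda>n. act (F n) w) \<longlongrightarrow> act f w) sequentially" if "F \<longlonglongrightarrow> f" for F f and w :: "real^'a"
    by (rule bounded_linear.tendsto[OF bounded_linear_act that])
  have Hh: "H \<longlonglongrightarrow> h" using h unfolding H_def .
  have Kk: "K \<longlonglongrightarrow> h - V" unfolding K_def by (intro tendsto_diff Hh W)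
  have orth: "(act (pos_part A) u \<bullet> act (K n) v + act (H n) u \<bullet> act (pos_part (- A)) v)
      + t n * (act (H n) u \<bullet> act (K n) v) = 0" for n u v
  proof -
    have "0 = act (pos_part A + t n *\<^sub>R H n) u \<bullet> act (pos_part (- A) + t n *\<^sub>R K n) v"
      using pos_part_orthogonal[of "A + t n *\<^sub>R W n" u v] unfolding X Y by simp
    also have "\<dots> = t n * ((act (pos_part A) u \<bullet> act (K n) v + act (H n) u \<bullet> act (pos_part (- A)) v)
      + t n * (act (H n) u \<bullet> act (K n) v))"
      using pos_part_orthogonal[of A u v] by (simp add: inner_add_left inner_add_right algebra_simps)
    finally show ?thesis using t(1)[of n] by simp
  qed
  have "(\<lambda>n. (act (pos_part A) u \<bullet> act (K n) v + act (H n) u \<bullet> act (pos_part (- A)) v)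
      + t n * (act (H n) u \<bullet> act (K n) v)) \<longlonglongrightarrow>
      (act (pos_part A) u \<bullet> act (h - V) v + act h u \<bullet> act (pos_part (- A)) v) + 0 * (act h u \<bullet> act (h - V) v)"
    by (intro tendsto_intros act Hh Kk t)
  then show "act (pos_part A) u \<bullet> act (h - V) v + act h u \<bullet> act (pos_part (- A)) v = 0"
    unfolding orth using LIMSEQ_unique[OF tendsto_const] by fastforce
  show "act h u \<bullet> act (h - V) v = 0" if "act (pos_part A) u = 0" "act (pos_part (- A)) v = 0"
  proof -
    have "act (H n) u \<bullet> act (K n) v = 0" for n using orth[of u n v] that t(1)[of n] by simp
    moreover have "(\<lambda>n. act (H n) u \<bullet> act (K n) v) \<longlonglongrightarrow> act h u \<bullet> act (h - V) v"
      by (intro tendsto_intros act Hh Kk)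
    ultimately show ?thesis using LIMSEQ_unique[OF tendsto_const] by fastforce
  qed
  show "0 \<le> u \<bullet> act h u" if "act A u = 0"
  proof (rule LIMSEQ_le_const)
    show "(\<lambda>n. u \<bullet> act (H n) u) \<longlonglongrightarrow> u \<bullet> act h u" by (intro tendsto_intros act Hh)
    have "0 \<le> u \<bullet> act (H n) u" for n
      using psd_pos_part(1)[of "A + t n *\<^sub>R W n"] pos_part_kernel[OF that] t(1)[of n]
      unfolding X psd_def by (auto simp: zero_le_mult_iff dest!: spec[of _ u])
    then show "\<exists>N. \<forall>n\<ge>N. 0 \<le> u \<bullet> act (H n) u" by blast
  qed
  show "0 \<le> u \<bullet> act (h - V) u" if "act A u = 0"
  proof (rule LIMSEQ_le_const)
    show "(\<lambda>n. u \<bullet> act (K n) u) \<longlonglongrightarrow> u \<bullet> act (h - V) u" by (intro tendsto_intros act Kk)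
    have "act (pos_part (- A)) u = 0" using that by (intro pos_part_kernel) simp
    then have "0 \<le> u \<bullet> act (K n) u" for n
      using psd_pos_part(1)[of "- (A + t n *\<^sub>R W n)"] t(1)[of n]
      unfolding Y psd_def by (auto simp: zero_le_mult_iff dest!: spec[of _ u])
    then show "\<exists>N. \<forall>n\<ge>N. 0 \<le> u \<bullet> act (K n) u" by blast
  qed
qed

lift_definition compression :: "'n symmat \<Rightarrow> 'n::finite symmat \<Rightarrow> 'n symmat" is "\<lambda>M A. M ** A ** M"
  by (simp add: matrix_transpose_mul matrix_mul_assoc)

lemma act_compression [simp]: "act (compression M A) v = act M (act A (act M v))"
  by (simp add: act_def compression.rep_eq matrix_vector_mul_assoc matrix_mul_assoc)

text \<open>
The first relation of \<open>pos_part_slope_properties\<close> fixes all entries of a slope, in an eigenbasis of \<open>A\<close>,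
except the block of the kernel of \<open>A\<close>. On this block a slope \<open>h\<close> and \<open>h - V\<close> are semidefinite and
complementary, so that \<open>h\<close> is the positive part of the block of \<open>V\<close>; uniqueness follows as for the
positive part itself, by expanding the squared norm of the difference of two slopes into inner products
of one slope \<open>h\<close> with \<open>g - V\<close> for another slope \<open>g\<close>.
\<close>

lemma pos_part_slope_unique:
  fixes A :: "'n::finite symmat"
  assumes h: "is_pos_part_slope A V h" and g: "is_pos_part_slope A V g"
  shows "h = g"
proof -
  obtain p a where p: "orthonormal p" and a: "\<And>l. act A (p l) = a l *\<^sub>R p l"
    using spectral_basis[of A] by blast
  have a': "act (- A) (p l) = (- a l) *\<^sub>R p l" for l by (simp add: a)
  note X = act_pos_part[OF p a] and Y = act_pos_part[OF p a']
  have pp: "p i \<bullet> p j = (if i = j then 1 else 0)" for i j using p by (simp add: orthonormal_def)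
  define J where "J = {l. a l = 0}"
  \<comment> \<open>The orthogonal projection onto the kernel of \<open>A\<close>.\<close>
  define M where "M = (\<Sum>l\<in>J. outer (p l))"
  have M: "act M v = (\<Sum>l\<in>J. (p l \<bullet> v) *\<^sub>R p l)" for v by (simp add: M_def act_sum_left)
  have AM: "act A (act M v) = 0" for v
    unfolding M by (simp add: linear_sum[OF linear_act] a J_def)
  have Mp: "act M (p j) = (if j \<in> J then p j else 0)" for j
  proof -
    have "act M (p j) = (\<Sum>l\<in>J. if l = j then p j else 0)"
      unfolding M by (intro sum.cong) (auto simp: pp)
    then show ?thesis by simp
  qed
  have entry: "max 0 (a i) * (p i \<bullet> act (h - V) (p j)) + max 0 (- a j) * (p i \<bullet> act h (p j)) = 0"
    if "is_pos_part_slope A V h" for h i j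
    using pos_part_slope_properties(1)[OF that, of "p i" "p j"] unfolding X Y
    by (simp add: act_self_adjoint)
  have off: "p i \<bullet> act h (p j) = 0 \<or> p i \<bullet> act (g - V) (p j) = 0"
    if h: "is_pos_part_slope A V h" and g: "is_pos_part_slope A V g" and ij: "j \<in> J" "i \<notin> J" for h g i j
  proof (cases "0 < a i")
    case True
    then show ?thesis using entry[OF g, of i j] ij by (simp add: J_def)
  next
    case False
    then have "a i < 0" using ij by (simp add: J_def)
    then show ?thesis using entry[OF h, of j i] ij by (simp add: J_def entry_symmetric[of p j _ i])
  qed
  \<comment> \<open>The inner product of the kernel blocks of \<open>h\<close> and \<open>g - V\<close>: by the preceding fact the rows outside
    the block contribute nothing.\<close>
  define c where "c h g = (\<Sum>j\<in>J. act h (p j) \<bullet> act (g - V) (p j))" for h g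
  have c_nonneg: "0 \<le> c h g" if h: "is_pos_part_slope A V h" and g: "is_pos_part_slope A V g" for h g
  proof -
    have "0 \<le> v \<bullet> act M (act h (act M v))" "0 \<le> v \<bullet> act M (act (g - V) (act M v))" for v
      using pos_part_slope_properties(3)[OF h AM, of v] pos_part_slope_properties(4)[OF g AM, of v]
      by (simp_all only: act_self_adjoint)
    then have "psd (compression M h)" "psd (compression M (g - V))"
      unfolding psd_def act_compression by blast+
    then have "0 \<le> compression M h \<bullet> compression M (g - V)" by (rule inner_psd_nonneg)
    also have "\<dots> = (\<Sum>j\<in>UNIV. if j \<in> J then act h (p j) \<bullet> act (g - V) (p j) else 0)"
      unfolding inner_symmat_orthonormal[OF p] act_compression
    proof (intro sum.cong refl)
      fix j
      show "act M (act h (act M (p j))) \<bullet> act M (act (g - V) (act M (p j)))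
          = (if j \<in> J then act h (p j) \<bullet> act (g - V) (p j) else 0)"
      proof (cases "j \<in> J")
        case True
        have "act M x \<bullet> p i = (if i \<in> J then x \<bullet> p i else 0)" for x i
          by (simp add: act_self_adjoint Mp)
        moreover have "(act h (p j) \<bullet> p i) * (act (g - V) (p j) \<bullet> p i) = 0" if "i \<notin> J" for i
          using off[OF h g True that] by (auto simp only: inner_commute[of _ "p i"])
        ultimately have "(act M (act h (p j)) \<bullet> p i) * (act M (act (g - V) (p j)) \<bullet> p i)
            = (act h (p j) \<bullet> p i) * (act (g - V) (p j) \<bullet> p i)" for i
          by (cases "i \<in> J") (simp_all del: act_simps)
        then have "act M (act h (p j)) \<bullet> act M (act (g - V) (p j)) = act h (p j) \<bullet> act (g - V) (p j)"
          using Parseval[OF p, of "act M (act h (p j))" "act M (act (g - V) (p j))"]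
            Parseval[OF p, of "act h (p j)" "act (g - V) (p j)"] by (simp only:)
        then show ?thesis using True Mp by (simp only: if_True)
      qed (simp add: Mp)
    qed
    also have "\<dots> = c h g" unfolding c_def by (simp add: sum.If_cases)
    finally show ?thesis .
  qed
  have c_zero: "c h h = 0" if "is_pos_part_slope A V h" for h
    unfolding c_def
  proof (intro sum.neutral ballI)
    fix j assume "j \<in> J"
    then show "act h (p j) \<bullet> act (h - V) (p j) = 0"
      by (intro pos_part_slope_properties(2)[OF that]) (simp_all add: X Y J_def)
  qed
  define d where "d = h - g"
  have "act d (p j) \<bullet> p i = 0" if "j \<notin> J" for i j
  proof -
    have "max 0 (a i) * (p i \<bullet> act d (p j)) + max 0 (- a j) * (p i \<bullet> act d (p j)) = 0" for i j
      using entry[OF h, of i j] entry[OF g, of i j] by (simp add: d_def inner_diff_right algebra_simps)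
    from this[of i j] this[of j i]
    have "(\<bar>a i\<bar> + \<bar>a j\<bar>) * (p i \<bullet> act d (p j)) = 0"
      unfolding pos_neg_abs[symmetric] entry_symmetric[of p j _ i] by (simp add: algebra_simps)
    then have "p i \<bullet> act d (p j) = 0" using that by (auto simp: J_def add_nonneg_eq_0_iff)
    then show ?thesis by (simp add: inner_commute)
  qed
  then have "act d (p j) \<bullet> act d (p j) = 0" if "j \<notin> J" for j
    using Parseval[OF p, of "act d (p j)" "act d (p j)"] that by simp
  then have "d \<bullet> d = (\<Sum>j\<in>UNIV. if j \<in> J then act d (p j) \<bullet> act d (p j) else 0)"
    unfolding inner_symmat_orthonormal[OF p] by (intro sum.cong) auto
  also have "\<dots> = (\<Sum>j\<in>J. act d (p j) \<bullet> act d (p j))" by (simp add: sum.If_cases)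
  also have "\<dots> = c h h + c g g - c h g - c g h"
    unfolding c_def d_def
    by (simp add: inner_diff_left inner_diff_right inner_commute sum_subtractf sum.distrib
        sum_distrib_left algebra_simps)
  also have "\<dots> \<le> 0" using c_zero[OF h] c_zero[OF g] c_nonneg[OF h g] c_nonneg[OF g h] by linarith
  finally have "d = 0" using inner_gt_zero_iff[of d] by fastforce
  then show "h = g" by (simp add: d_def)
qed

lemma pos_part_directional_derivative:
  fixes A V :: "'n::finite symmat"
  obtains h where "\<And>W t. W \<longlonglongrightarrow> V \<Longrightarrow> (\<And>n. 0 < t n) \<Longrightarrow> t \<longlonglongrightarrow> 0
    \<Longrightarrow> (\<lambda>n. (pos_part (A + t n *\<^sub>R W n) - pos_part A) /\<^sub>R t n) \<longlonglongrightarrow> h"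
proof -
  let ?H = "\<lambda>(W :: nat \<Rightarrow> 'n symmat) t n. (pos_part (A + t n *\<^sub>R W n) - pos_part A) /\<^sub>R t n"
  have bd: "bounded (range (?H W t))" if W: "W \<longlonglongrightarrow> V" and t: "\<And>n. 0 < t n" for W t
  proof -
    obtain K where K: "\<And>n. norm (W n) \<le> K"
      using convergent_imp_bounded[OF W] by (auto simp: bounded_iff)
    have "norm (?H W t n) \<le> K" for n
    proof -
      have "norm (?H W t n) = norm (pos_part (A + t n *\<^sub>R W n) - pos_part A) / t n"
        using t[of n] by (simp add: divide_inverse mult.commute)
      also have "\<dots> \<le> norm (W n)"
        using pos_part_nonexpansive[of "A + t n *\<^sub>R W n" A] t[of n]
        by (simp add: pos_divide_le_eq mult.commute)
      finally have "norm (?H W t n) \<le> norm (W n)" .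
      then show ?thesis using K[of n] by linarith
    qed
    then show ?thesis unfolding bounded_iff by blast
  qed
  define t0 where "t0 n = 1 / real (Suc n)" for n
  have t0: "t0 \<longlonglongrightarrow> 0" "\<And>n. 0 < t0 n" unfolding t0_def by (rule LIMSEQ_Suc[OF lim_1_over_n], simp)
  obtain h r where r: "strict_mono r" "(?H (\<lambda>_. V) t0 \<circ> r) \<longlonglongrightarrow> h"
    using bounded_imp_convergent_subsequence[of "?H (\<lambda>_. V) t0"] bd[where W="\<lambda>_. V" and t=t0, OF tendsto_const t0(2)] by blast
  have "is_pos_part_slope A V h"
    unfolding is_pos_part_slope_def using r t0 LIMSEQ_subseq_LIMSEQ[OF t0(1) r(1)]
    by (intro exI[of _ "\<lambda>_. V"] exI[of _ "t0 \<circ> r"]) (simp add: comp_def)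
  then have uniq: "h' = h" if "is_pos_part_slope A V h'" for h' using pos_part_slope_unique that by blast
  have "?H W t \<longlonglongrightarrow> h" if W: "W \<longlonglongrightarrow> V" and t: "\<And>n. 0 < t n" "t \<longlonglongrightarrow> 0" for W t
  proof (rule tendsto_if_unique_cluster_point[OF bd[OF W t(1)]])
    fix r :: "nat \<Rightarrow> nat" and h' assume r: "strict_mono r" "(?H W t \<circ> r) \<longlonglongrightarrow> h'"
    have "is_pos_part_slope A V h'"
      unfolding is_pos_part_slope_def
      using r t LIMSEQ_subseq_LIMSEQ[OF t(2) r(1)] LIMSEQ_subseq_LIMSEQ[OF W r(1)]
      by (intro exI[of _ "W \<circ> r"] exI[of _ "t \<circ> r"]) (simp add: comp_def)
    then show "h' = h" by (rule uniq)
  qed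
  then show thesis using that by blast
qed

text \<open>
By Euler's identity $D_n W_n$ is the difference quotient of the positive part between \<open>A\<close> and
$A + t_n W_n$ minus $(D_n A - A_+)/t_n$, and the latter is $O(t_n)$.
\<close>

lemma pos_part_semismooth_sequence:
  fixes A V :: "'n::finite symmat"
  obtains l where "\<And>W t D. W \<longlonglongrightarrow> V \<Longrightarrow> (\<And>n. 0 < t n) \<Longrightarrow> t \<longlonglongrightarrow> 0
    \<Longrightarrow> (\<And>n. (pos_part has_derivative D n) (at (A + t n *\<^sub>R W n)))
    \<Longrightarrow> (\<And>n v. act (A + t n *\<^sub>R W n) v = 0 \<Longrightarrow> v = 0)
    \<Longrightarrow> (\<lambda>n. D n (W n)) \<longlonglongrightarrow> l"
proof -
  obtain l where l: "\<And>W t. W \<longlonglongrightarrow> V \<Longrightarrow> (\<And>n. 0 < t n) \<Longrightarrow> t \<longlonglongrightarrow> 0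
    \<Longrightarrow> (\<lambda>n. (pos_part (A + t n *\<^sub>R W n) - pos_part A) /\<^sub>R t n) \<longlonglongrightarrow> l"
    using pos_part_directional_derivative[where A=A and V=V] by blast
  obtain C where C: "\<And>B D. (pos_part has_derivative D) (at B) \<Longrightarrow> (\<And>v. act B v = 0 \<Longrightarrow> v = 0)
    \<Longrightarrow> norm (D A - pos_part A) \<le> C * (norm (B - A))\<^sup>2"
    using pos_part_strongly_semismooth[of A] by blast
  have "(\<lambda>n. D n (W n)) \<longlonglongrightarrow> l"
    if W: "W \<longlonglongrightarrow> V" and t: "\<And>n. 0 < t n" "t \<longlonglongrightarrow> 0"
      and D: "\<And>n. (pos_part has_derivative D n) (at (A + t n *\<^sub>R W n))"
      and inv: "\<And>n v. act (A + t n *\<^sub>R W n) v = 0 \<Longrightarrow> v = 0" for W t D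
  proof -
    define e where "e n = (D n A - pos_part A) /\<^sub>R t n" for n
    have DW: "D n (W n) = (pos_part (A + t n *\<^sub>R W n) - pos_part A) /\<^sub>R t n - e n" for n
    proof -
      have lin: "linear (D n)" using D has_derivative_linear by blast
      have "pos_part (A + t n *\<^sub>R W n) = D n A + t n *\<^sub>R D n (W n)"
        using pos_part_Euler[OF D[of n] inv[of n]] by (simp add: linear_add[OF lin] linear_scale[OF lin])
      then show ?thesis using t(1)[of n] by (simp add: e_def flip: scaleR_diff_right)
    qed
    have "norm (e n) \<le> C * (t n * (norm (W n))\<^sup>2)" for n
    proof -
      have "norm (D n A - pos_part A) \<le> C * (norm (t n *\<^sub>R W n))\<^sup>2" using C[OF D inv, of n] by simp
      moreover have "norm (e n) = norm (D n A - pos_part A) / t n"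
        using t(1)[of n] by (simp add: e_def divide_inverse mult.commute)
      ultimately show ?thesis
        using t(1)[of n] by (simp add: pos_divide_le_eq power2_eq_square mult_ac)
    qed
    moreover have "(\<lambda>n. C * (t n * (norm (W n))\<^sup>2)) \<longlonglongrightarrow> C * (0 * (norm V)\<^sup>2)"
      by (intro tendsto_intros W t)
    ultimately have "e \<longlonglongrightarrow> 0"
      by (intro Lim_null_comparison[of e]) auto
    then have "(\<lambda>n. (pos_part (A + t n *\<^sub>R W n) - pos_part A) /\<^sub>R t n - e n) \<longlonglongrightarrow> l - 0"
      by (intro tendsto_diff l[OF W t])
    then show ?thesis unfolding DW by simp
  qed
  then show thesis using that by blast
qed

section \<open>Semismoothness of the gradient\<close>

text \<open>
Clarke's Jacobian is generated from derivatives at nearby points by limits and convex combinations. A point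
near $A + tW$ is again of the form $A + tZ$ with $Z$ near $W$, so a bound $|DZ - l| \le e$ at points of
differentiability, uniform near the direction \<open>V\<close>, passes to limits; it passes to convex combinations
because balls are convex.
\<close>

lemma semismoothI:
  fixes F :: "'a::euclidean_space \<Rightarrow> 'b::euclidean_space"
  assumes lip: "locally_lipschitz F"
    and lim: "\<And>A V. \<exists>l. \<forall>W t D. W \<longlonglongrightarrow> V \<longrightarrow> (\<forall>n. 0 < t n) \<longrightarrow> t \<longlonglongrightarrow> (0::real)
      \<longrightarrow> (\<forall>n. (F has_derivative D n) (at (A + t n *\<^sub>R W n))) \<longrightarrow> (\<lambda>n. D n (W n)) \<longlonglongrightarrow> l"
  shows "semismooth F"
  unfolding semismooth_def
proof (intro conjI lip allI)
  fix A V
  obtain l where l: "\<And>W t D. W \<longlonglongrightarrow> V \<Longrightarrow> (\<And>n. 0 < t n) \<Longrightarrow> t \<longlonglongrightarrow> (0::real)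
      \<Longrightarrow> (\<And>n. (F has_derivative D n) (at (A + t n *\<^sub>R W n))) \<Longrightarrow> (\<lambda>n. D n (W n)) \<longlonglongrightarrow> l"
    using lim[of V A] by blast
  have unif: "\<exists>d>0. \<forall>W t D. norm (W - V) < d \<longrightarrow> 0 < t \<longrightarrow> t < d \<longrightarrow>
      (F has_derivative D) (at (A + t *\<^sub>R W)) \<longrightarrow> norm (D W - l) \<le> e" if "0 < e" for e
  proof (rule ccontr)
    assume "\<not> ?thesis"
    then have "\<forall>n. \<exists>W t D. norm (W - V) < 1 / real (Suc n) \<and> 0 < t \<and> t < 1 / real (Suc n) \<and>
      (F has_derivative D) (at (A + t *\<^sub>R W)) \<and> \<not> norm (D W - l) \<le> e"
      by (meson of_nat_0_less_iff zero_less_Suc zero_less_divide_1_iff)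
    then obtain W t D where *: "\<And>n. norm (W n - V) < 1 / real (Suc n)" "\<And>n. 0 < t n" "\<And>n. t n < 1 / real (Suc n)"
      "\<And>n. (F has_derivative D n) (at (A + t n *\<^sub>R W n))" "\<And>n. \<not> norm (D n (W n) - l) \<le> e"
      by metis
    have inv: "(\<lambda>n. 1 / real (Suc n)) \<longlonglongrightarrow> 0" by (rule LIMSEQ_Suc[OF lim_1_over_n])
    have "(\<lambda>n. W n - V) \<longlonglongrightarrow> 0"
      by (rule Lim_null_comparison[OF _ inv]) (auto intro!: always_eventually less_imp_le * simp del: of_nat_Suc)
    then have "W \<longlonglongrightarrow> V" by (simp add: LIM_zero_iff)
    moreover have "t \<longlonglongrightarrow> 0"
    proof (rule Lim_null_comparison[OF _ inv], intro always_eventually allI)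
      fix n show "norm (t n) \<le> 1 / real (Suc n)" using *(2,3)[of n] by simp
    qed
    ultimately have "(\<lambda>n. D n (W n)) \<longlonglongrightarrow> l" using * by (intro l) auto
    then have "\<exists>n. norm (D n (W n) - l) < e" using that by (auto simp: LIMSEQ_iff)
    then show False using *(5) by (meson less_imp_le)
  qed
  show "\<exists>l. \<forall>W t G. W \<longlonglongrightarrow> V \<and> (\<forall>n. t n > 0) \<and> t \<longlonglongrightarrow> 0
      \<and> (\<forall>n. G n \<in> clarke_jacobian F (A + t n *\<^sub>R W n)) \<longrightarrow> (\<lambda>n. blinfun_apply (G n) (W n)) \<longlonglongrightarrow> l"
  proof (intro exI[of _ l] allI impI, elim conjE)
    fix W :: "nat \<Rightarrow> 'a" and t :: "nat \<Rightarrow> real" and G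
    assume W: "W \<longlonglongrightarrow> V" and t: "\<forall>n. t n > 0" "t \<longlonglongrightarrow> 0"
      and G: "\<forall>n. G n \<in> clarke_jacobian F (A + t n *\<^sub>R W n)"
    have close: "norm (blinfun_apply J w - l) \<le> e"
      if d: "\<And>W t D. norm (W - V) < d \<Longrightarrow> 0 < t \<Longrightarrow> t < d \<Longrightarrow>
          (F has_derivative D) (at (A + t *\<^sub>R W)) \<Longrightarrow> norm (D W - l) \<le> e"
        and w: "norm (w - V) < d" "0 < s" "s < d" and J: "J \<in> clarke_jacobian F (A + s *\<^sub>R w)"
      for d e w s J
    proof -
      have "clarke_jacobian F (A + s *\<^sub>R w) \<subseteq> {J. norm (blinfun_apply J w - l) \<le> e}"
        unfolding clarke_jacobian_def
      proof (rule hull_minimal)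
        have "{J. norm (blinfun_apply J w - l) \<le> e} = (\<lambda>J. blinfun_apply J w) -` cball l e"
          by (auto simp: dist_norm norm_minus_commute)
        then show "convex {J. norm (blinfun_apply J w - l) \<le> e}"
          by (simp add: convex_linear_vimage bounded_linear.linear bounded_linear_intros)
        show "{G. \<exists>X D. X \<longlonglongrightarrow> A + s *\<^sub>R w \<and> (\<forall>n. (F has_derivative blinfun_apply (D n)) (at (X n))) \<and> D \<longlonglongrightarrow> G}
            \<subseteq> {J. norm (blinfun_apply J w - l) \<le> e}"
        proof (clarify)
          fix J X D assume X: "X \<longlonglongrightarrow> A + s *\<^sub>R w"
            and D: "\<forall>n. (F has_derivative blinfun_apply (D n)) (at (X n))" and DJ: "D \<longlonglongrightarrow> J"
          define Z where "Z n = (X n - A) /\<^sub>R s" for n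
          have XZ: "X n = A + s *\<^sub>R Z n" for n using w(2) by (simp add: Z_def)
          have "Z \<longlonglongrightarrow> (A + s *\<^sub>R w - A) /\<^sub>R s" unfolding Z_def by (intro tendsto_intros X)
          then have Z: "Z \<longlonglongrightarrow> w" using w(2) by simp
          have "(\<lambda>n. norm (Z n - V)) \<longlonglongrightarrow> norm (w - V)" by (intro tendsto_intros Z)
          then have "\<forall>\<^sub>F n in sequentially. norm (Z n - V) < d" using w(1) by (rule order_tendstoD)
          then have "\<forall>\<^sub>F n in sequentially. norm (blinfun_apply (D n) (Z n) - l) \<le> e"
            by (rule eventually_mono) (use d w D XZ in auto)
          moreover have "(\<lambda>n. norm (blinfun_apply (D n) (Z n) - l)) \<longlonglongrightarrow> norm (blinfun_apply J w - l)"
            by (intro tendsto_intros DJ Z)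
          ultimately show "norm (blinfun_apply J w - l) \<le> e"
            by (intro tendsto_upperbound[of _ _ sequentially]) auto
        qed
      qed
      then show ?thesis using J by blast
    qed
    show "(\<lambda>n. blinfun_apply (G n) (W n)) \<longlonglongrightarrow> l"
      unfolding tendsto_iff
    proof (intro allI impI)
      fix e :: real assume "0 < e"
      then obtain d where d: "0 < d" "\<And>W t D. norm (W - V) < d \<Longrightarrow> 0 < t \<Longrightarrow> t < d \<Longrightarrow>
          (F has_derivative D) (at (A + t *\<^sub>R W)) \<Longrightarrow> norm (D W - l) \<le> e / 2"
        using unif[of "e / 2"] by auto
      have "\<forall>\<^sub>F n in sequentially. dist (W n) V < d" "\<forall>\<^sub>F n in sequentially. t n < d"
        using W t(2) d(1) by (auto intro: tendstoD order_tendstoD)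
      then show "\<forall>\<^sub>F n in sequentially. dist (blinfun_apply (G n) (W n)) l < e"
      proof eventually_elim
        case (elim n)
        then have "norm (blinfun_apply (G n) (W n) - l) \<le> e / 2"
          using t(1) G d(2) by (intro close[of d "e / 2" _ "t n"]) (auto simp: dist_norm)
        then show ?case using \<open>0 < e\<close> by (simp add: dist_norm)
      qed
    qed
  qed
qed

lemma max_0_trace_has_derivative:
  fixes B :: "'n::finite symmat"
  assumes "B \<bullet> identity \<noteq> 0"
  shows "((\<lambda>E. max 0 (E \<bullet> identity)) has_derivative (\<lambda>H. if 0 < B \<bullet> identity then H \<bullet> identity else 0)) (at B)"
proof (cases "0 < B \<bullet> identity")
  case True
  have op: "open {E :: 'n symmat. 0 < E \<bullet> identity}" by (intro open_Collect_less continuous_intros)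
  have "((\<lambda>E. E \<bullet> identity) has_derivative (\<lambda>H. H \<bullet> identity)) (at B)"
    by (intro has_derivative_inner_left has_derivative_ident)
  then have "((\<lambda>E. max 0 (E \<bullet> identity)) has_derivative (\<lambda>H. H \<bullet> identity)) (at B)"
    by (rule has_derivative_transform_within_open[OF _ op]) (use True in auto)
  then show ?thesis using True by simp
next
  case False
  have op: "open {E :: 'n symmat. E \<bullet> identity < 0}" by (intro open_Collect_less continuous_intros)
  have "((\<lambda>E. max 0 (E \<bullet> identity)) has_derivative (\<lambda>H. 0)) (at B)"
    by (rule has_derivative_transform_within_open[OF has_derivative_const[where c=0] op]) (use False assms in auto)
  then show ?thesis using False by simp
qed

text \<open>
The scalar analogue of \<open>pos_part_semismooth_sequence\<close>. If the trace of \<open>A\<close> vanishes, the sign of the trace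
along the sequence is that of the trace of $W_n$, and the expression is $\max(0, \mathrm{tr}\,W_n)$.
\<close>

lemma max_0_trace_semismooth_sequence:
  fixes A V :: "'n::finite symmat"
  obtains l where "\<And>W t. W \<longlonglongrightarrow> V \<Longrightarrow> (\<And>n. 0 < t n) \<Longrightarrow> t \<longlonglongrightarrow> 0
    \<Longrightarrow> (\<lambda>n. if 0 < (A + t n *\<^sub>R W n) \<bullet> identity then W n \<bullet> identity else 0) \<longlonglongrightarrow> l"
proof -
  define l where "l = (if A \<bullet> identity = 0 then max 0 (V \<bullet> identity) else if 0 < A \<bullet> identity then V \<bullet> identity else 0)"
  have "(\<lambda>n. if 0 < (A + t n *\<^sub>R W n) \<bullet> identity then W n \<bullet> identity else 0) \<longlonglongrightarrow> l"
    if W: "W \<longlonglongrightarrow> V" and t: "\<And>n. 0 < t n" "t \<longlonglongrightarrow> 0" for W t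
  proof -
    have lim: "(\<lambda>n. (A + t n *\<^sub>R W n) \<bullet> identity) \<longlonglongrightarrow> (A + 0 *\<^sub>R V) \<bullet> identity"
      by (intro tendsto_intros W t)
    have trV: "(\<lambda>n. W n \<bullet> identity) \<longlonglongrightarrow> V \<bullet> identity" by (intro tendsto_intros W)
    consider "A \<bullet> identity = 0" | "0 < A \<bullet> identity" | "A \<bullet> identity < 0" by linarith
    then show ?thesis
    proof cases
      case 1
      have "(if 0 < (A + t n *\<^sub>R W n) \<bullet> identity then W n \<bullet> identity else 0) = max 0 (W n \<bullet> identity)" for n
        using t(1)[of n] 1 by (simp add: inner_add_left zero_less_mult_iff max_def)
      moreover have "(\<lambda>n. max 0 (W n \<bullet> identity)) \<longlonglongrightarrow> max 0 (V \<bullet> identity)"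
        by (intro tendsto_max tendsto_const trV)
      ultimately show ?thesis using 1 by (simp add: l_def)
    next
      case 2
      then have "\<forall>\<^sub>F n in sequentially. 0 < (A + t n *\<^sub>R W n) \<bullet> identity"
        using order_tendstoD(1)[OF lim] by simp
      then have "\<forall>\<^sub>F n in sequentially. W n \<bullet> identity
          = (if 0 < (A + t n *\<^sub>R W n) \<bullet> identity then W n \<bullet> identity else 0)"
        by eventually_elim simp
      from Lim_transform_eventually[OF trV this] 2 show ?thesis by (simp add: l_def)
    next
      case 3
      then have "\<forall>\<^sub>F n in sequentially. (A + t n *\<^sub>R W n) \<bullet> identity < 0"
        using order_tendstoD(2)[OF lim] by simp
      then have "\<forall>\<^sub>F n in sequentially. 0
          = (if 0 < (A + t n *\<^sub>R W n) \<bullet> identity then W n \<bullet> identity else 0)"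
        by eventually_elim simp
      from Lim_transform_eventually[OF tendsto_const this] 3 show ?thesis by (simp add: l_def)
    qed
  qed
  then show thesis using that by blast
qed

text \<open>
Differentiability of the sum \<open>stress_plus\<close> entails that of both summands, since neither kink can be cancelled
by the other; thus the limits for the summands can be added.
\<close>

lemma stress_plus_semismooth_sequence:
  fixes A V :: "'n::finite symmat"
  assumes lam: "0 \<le> lam" and mu: "0 < mu"
  obtains l where "\<And>W t D. W \<longlonglongrightarrow> V \<Longrightarrow> (\<And>n. 0 < t n) \<Longrightarrow> t \<longlonglongrightarrow> 0
    \<Longrightarrow> (\<And>n. (stress_plus lam mu has_derivative D n) (at (A + t n *\<^sub>R W n)))
    \<Longrightarrow> (\<lambda>n. D n (W n)) \<longlonglongrightarrow> l"
proof -
  obtain p where p: "\<And>W t D. W \<longlonglongrightarrow> V \<Longrightarrow> (\<And>n. 0 < t n) \<Longrightarrow> t \<longlonglongrightarrow> 0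
    \<Longrightarrow> (\<And>n. (pos_part has_derivative D n) (at (A + t n *\<^sub>R W n)))
    \<Longrightarrow> (\<And>n v. act (A + t n *\<^sub>R W n) v = 0 \<Longrightarrow> v = 0) \<Longrightarrow> (\<lambda>n. D n (W n)) \<longlonglongrightarrow> p"
    using pos_part_semismooth_sequence[of V A] by blast
  obtain q where q: "\<And>W t. W \<longlonglongrightarrow> V \<Longrightarrow> (\<And>n. 0 < t n) \<Longrightarrow> t \<longlonglongrightarrow> 0
    \<Longrightarrow> (\<lambda>n. if 0 < (A + t n *\<^sub>R W n) \<bullet> identity then W n \<bullet> identity else 0) \<longlonglongrightarrow> q"
    using max_0_trace_semismooth_sequence[of V A] by blast
  have "(\<lambda>n. D n (W n)) \<longlonglongrightarrow> (lam * q) *\<^sub>R identity + (2 * mu) *\<^sub>R p"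
    if W: "W \<longlonglongrightarrow> V" and t: "\<And>n. 0 < t n" "t \<longlonglongrightarrow> 0"
      and D: "\<And>n. (stress_plus lam mu has_derivative D n) (at (A + t n *\<^sub>R W n))" for W t D
  proof -
    define B where "B n = A + t n *\<^sub>R W n" for n
    \<comment> \<open>The derivative of the trace term. For \<open>lam = 0\<close> the term vanishes identically, so that the trace
      of \<open>B n\<close> may be zero.\<close>
    define T where "T n H = (lam * (if 0 < B n \<bullet> identity then H \<bullet> identity else 0)) *\<^sub>R (identity :: 'n symmat)" for n and H :: "'n symmat"
    define P where "P n H = (D n H - T n H) /\<^sub>R (2 * mu)" for n H
    have T: "((\<lambda>E :: 'n symmat. (lam * max 0 (E \<bullet> identity)) *\<^sub>R identity) has_derivative T n) (at (B n))" for n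
    proof (cases "lam = 0")
      case False
      then have "B n \<bullet> identity \<noteq> 0"
        using lam mu D unfolding B_def by (intro stress_plus_differentiable_imp_trace[of lam mu]) auto
      then show ?thesis unfolding T_def
        by (intro has_derivative_scaleR_left has_derivative_mult_right max_0_trace_has_derivative)
    qed (simp add: T_def[abs_def])
    have "((\<lambda>E :: 'n symmat. (stress_plus lam mu E - (lam * max 0 (E \<bullet> identity)) *\<^sub>R identity) /\<^sub>R (2 * mu)) has_derivative P n) (at (B n))" for n
      unfolding P_def using D[of n] T[of n] unfolding B_def by (intro has_derivative_scaleR_right has_derivative_diff)
    moreover have "(\<lambda>E :: 'n symmat. (stress_plus lam mu E - (lam * max 0 (E \<bullet> identity)) *\<^sub>R identity) /\<^sub>R (2 * mu)) = pos_part"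
      using mu by (simp add: stress_plus_def fun_eq_iff)
    ultimately have P: "(pos_part has_derivative P n) (at (A + t n *\<^sub>R W n))" for n
      unfolding B_def by simp
    have "(\<lambda>n. P n (W n)) \<longlonglongrightarrow> p"
      by (rule p[OF W t P]) (rule stress_plus_differentiable_imp_invertible[OF lam mu D])
    moreover have "(\<lambda>n. T n (W n)) \<longlonglongrightarrow> (lam * q) *\<^sub>R identity"
      unfolding T_def B_def by (intro tendsto_intros q[OF W t])
    ultimately have "(\<lambda>n. T n (W n) + (2 * mu) *\<^sub>R P n (W n)) \<longlonglongrightarrow> (lam * q) *\<^sub>R identity + (2 * mu) *\<^sub>R p"
      by (intro tendsto_intros)
    then show ?thesis using mu by (simp add: P_def)
  qed
  then show thesis using that by blast
qed

lemma bounded_linear_elastic_stress: "bounded_linear (elastic_stress lam mu)"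
proof -
  have "linear (elastic_stress lam mu)"
    by (rule linearI) (simp_all add: elastic_stress_def inner_add_left algebra_simps)
  then show ?thesis by (simp add: linear_conv_bounded_linear)
qed

lemma elastic_stress_has_derivative: "(elastic_stress lam mu has_derivative elastic_stress lam mu) (at B)"
  by (rule bounded_linear_imp_has_derivative[OF bounded_linear_elastic_stress])

lemma stress_plus_has_derivative_from_stress:
  fixes B :: "'n::finite symmat"
  assumes "a \<noteq> b" and D: "(stress lam mu a b has_derivative D) (at B)"
  shows "(stress_plus lam mu has_derivative (\<lambda>H. (b *\<^sub>R elastic_stress lam mu H - D H) /\<^sub>R (b - a))) (at B)"
proof -
  have "((\<lambda>E. (b *\<^sub>R elastic_stress lam mu E - stress lam mu a b E) /\<^sub>R (b - a)) has_derivative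
      (\<lambda>H. (b *\<^sub>R elastic_stress lam mu H - D H) /\<^sub>R (b - a))) (at B)"
    by (intro has_derivative_scaleR_right has_derivative_diff elastic_stress_has_derivative D)
  moreover have "(\<lambda>E :: 'n symmat. (b *\<^sub>R elastic_stress lam mu E - stress lam mu a b E) /\<^sub>R (b - a)) = stress_plus lam mu"
    using assms(1) by (simp add: stress_eq fun_eq_iff)
  ultimately show ?thesis by simp
qed

lemma locally_lipschitzI:
  fixes F :: "'a::real_normed_vector \<Rightarrow> 'b::real_normed_vector"
  assumes "\<And>x y. norm (F x - F y) \<le> L * norm (x - y)"
  shows "locally_lipschitz F"
  unfolding locally_lipschitz_def
proof
  fix x
  have "\<bar>L\<bar>-lipschitz_on (cball x 1) F"
  proof (rule lipschitz_onI)
    fix y z :: 'a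
    have "L * norm (y - z) \<le> \<bar>L\<bar> * norm (y - z)" by (intro mult_right_mono) auto
    then show "dist (F y) (F z) \<le> \<bar>L\<bar> * dist y z" using assms[of y z] by (simp add: dist_norm)
  qed simp
  then show "\<exists>u>0. \<exists>L. L-lipschitz_on (cball x u) F" by (intro exI[of _ 1]) auto
qed

lemma semismooth_stress:
  fixes lam mu a b :: real
  assumes lam: "0 \<le> lam" and mu: "0 < mu" and ab: "0 \<le> a" "0 \<le> b"
  shows "semismooth (stress lam mu a b :: 'n::finite symmat \<Rightarrow> 'n symmat)"
proof (rule semismoothI)
  show "locally_lipschitz (stress lam mu a b :: 'n symmat \<Rightarrow> 'n symmat)"
    by (rule locally_lipschitzI, rule stress_Lipschitz) (use lam mu ab in auto)
  fix A V :: "'n symmat"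
  have E: "(\<lambda>n. elastic_stress lam mu (W n)) \<longlonglongrightarrow> elastic_stress lam mu V" if "W \<longlonglongrightarrow> V" for W
    by (rule bounded_linear.tendsto[OF bounded_linear_elastic_stress that])
  show "\<exists>l. \<forall>W t D. W \<longlonglongrightarrow> V \<longrightarrow> (\<forall>n. 0 < t n) \<longrightarrow> t \<longlonglongrightarrow> (0::real)
      \<longrightarrow> (\<forall>n. (stress lam mu a b has_derivative D n) (at (A + t n *\<^sub>R W n))) \<longrightarrow> (\<lambda>n. D n (W n)) \<longlonglongrightarrow> l"
  proof (cases "a = b")
    case True
    then have st: "stress lam mu a b = (\<lambda>E. b *\<^sub>R elastic_stress lam mu E)" by (simp add: stress_eq fun_eq_iff)
    have der: "(stress lam mu a b has_derivative (\<lambda>E. b *\<^sub>R elastic_stress lam mu E)) (at B)" for B :: "'n symmat"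
      unfolding st by (intro has_derivative_scaleR_right elastic_stress_has_derivative)
    show ?thesis
    proof (intro exI allI impI)
      fix W t D assume W: "W \<longlonglongrightarrow> V" and D: "\<forall>n. (stress lam mu a b has_derivative D n) (at (A + t n *\<^sub>R W n))"
      have "D n = (\<lambda>E. b *\<^sub>R elastic_stress lam mu E)" for n using has_derivative_unique[OF D[rule_format] der] .
      then show "(\<lambda>n. D n (W n)) \<longlonglongrightarrow> b *\<^sub>R elastic_stress lam mu V" by (simp add: tendsto_scaleR E[OF W])
    qed
  next
    case False
    obtain l where l: "\<And>W t D. W \<longlonglongrightarrow> V \<Longrightarrow> (\<And>n. 0 < t n) \<Longrightarrow> t \<longlonglongrightarrow> 0
      \<Longrightarrow> (\<And>n. (stress_plus lam mu has_derivative D n) (at (A + t n *\<^sub>R W n))) \<Longrightarrow> (\<lambda>n. D n (W n)) \<longlonglongrightarrow> l"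
      using stress_plus_semismooth_sequence[OF lam mu, of V A] by blast
    show ?thesis
    proof (intro exI allI impI)
      fix W t D assume W: "W \<longlonglongrightarrow> V" and t: "\<forall>n. 0 < t n" "t \<longlonglongrightarrow> 0"
        and D: "\<forall>n. (stress lam mu a b has_derivative D n) (at (A + t n *\<^sub>R W n))"
      have "(\<lambda>n. (b *\<^sub>R elastic_stress lam mu (W n) - D n (W n)) /\<^sub>R (b - a)) \<longlonglongrightarrow> l"
        using W t D by (intro l stress_plus_has_derivative_from_stress False) auto
      then have "(\<lambda>n. b *\<^sub>R elastic_stress lam mu (W n)
          - (b - a) *\<^sub>R ((b *\<^sub>R elastic_stress lam mu (W n) - D n (W n)) /\<^sub>R (b - a)))
          \<longlonglongrightarrow> b *\<^sub>R elastic_stress lam mu V - (b - a) *\<^sub>R l"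
        by (intro tendsto_intros E W)
      then show "(\<lambda>n. D n (W n)) \<longlonglongrightarrow> b *\<^sub>R elastic_stress lam mu V - (b - a) *\<^sub>R l"
        using False by simp
    qed
  qed
qed

section \<open>Smoothness of the energy\<close>

lemma GDERIV_blinfun: "GDERIV f x :> D \<longleftrightarrow> (f has_derivative blinfun_apply (blinfun_inner_left D)) (at x)"
  by (simp add: gderiv_def blinfun_inner_left.rep_eq)

lemma C11_if_gradient_Lipschitz:
  fixes f :: "'a::real_inner \<Rightarrow> real" and F :: "'a \<Rightarrow> 'a"
  assumes f: "\<And>x. GDERIV f x :> F x" and L: "\<And>x y. norm (F x - F y) \<le> L * norm (x - y)"
  shows "C11 f"
  unfolding C11_def
proof (intro exI conjI allI)
  show "(f has_derivative blinfun_apply (blinfun_inner_left (F x))) (at x)" for x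
    using f by (simp add: GDERIV_blinfun)
  show "locally_lipschitz (\<lambda>x. blinfun_inner_left (F x))"
  proof (rule locally_lipschitzI)
    fix x y
    have "norm (blinfun_inner_left (F x) - blinfun_inner_left (F y)) = norm (blinfun_inner_left (F x - F y))"
      by (simp add: linear_diff[OF bounded_linear.linear[OF bounded_linear_blinfun_inner_left]])
    also have "\<dots> \<le> norm (F x - F y)"
      by (rule norm_blinfun_bound) (auto simp: Cauchy_Schwarz_ineq2 mult.commute)
    finally show "norm (blinfun_inner_left (F x) - blinfun_inner_left (F y)) \<le> L * norm (x - y)"
      using L[of x y] by linarith
  qed
qed

lemma C2_on_affine:
  fixes g :: "'a::real_normed_vector \<Rightarrow> real"
  assumes "C2_on S g"
  shows "C2_on S (\<lambda>x. (g x + k) * p + q)"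
proof -
  obtain g' g'' where g: "\<And>x. x \<in> S \<Longrightarrow> (g has_derivative blinfun_apply (g' x)) (at x within S)"
      "\<And>x. x \<in> S \<Longrightarrow> (g' has_derivative blinfun_apply (g'' x)) (at x within S)" "continuous_on S g''"
    using assms unfolding C2_on_def by blast
  have "((\<lambda>x. (g x + k) * p + q) has_derivative blinfun_apply (p *\<^sub>R g' x)) (at x within S)" if "x \<in> S" for x
    using g(1)[OF that] by (auto intro!: derivative_eq_intros simp: scaleR_blinfun.rep_eq)
  moreover have "((\<lambda>x. p *\<^sub>R g' x) has_derivative blinfun_apply (p *\<^sub>R g'' x)) (at x within S)" if "x \<in> S" for x
    using has_derivative_scaleR_right[OF g(2)[OF that], of p] by (simp add: scaleR_blinfun.rep_eq)
  moreover have "continuous_on S (\<lambda>x. p *\<^sub>R g'' x)" by (intro continuous_intros g)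
  ultimately show ?thesis unfolding C2_on_def
    by (intro exI[of _ "\<lambda>x. p *\<^sub>R g' x"] exI[of _ "\<lambda>x. p *\<^sub>R g'' x"]) auto
qed

lemma gradient_differentiable_if_C2:
  fixes f :: "'a::euclidean_space \<Rightarrow> real" and F :: "'a \<Rightarrow> 'a"
  assumes "C2_on UNIV f" and f: "\<And>x. GDERIV f x :> F x"
  obtains D where "(F has_derivative D) (at x)"
proof -
  obtain f' f'' where *: "\<And>x. (f has_derivative blinfun_apply (f' x)) (at x)"
      "\<And>x. (f' has_derivative blinfun_apply (f'' x)) (at x)"
    using assms(1) unfolding C2_on_def by auto
  have "blinfun_apply (f' y) = (\<lambda>h. h \<bullet> F y)" for y
    using has_derivative_unique[OF *(1) f[unfolded gderiv_def]] .
  then have F: "F = (\<lambda>y. \<Sum>i\<in>Basis. blinfun_apply (f' y) i *\<^sub>R i)"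
    by (simp add: fun_eq_iff inner_commute[of _ "F _"] euclidean_representation)
  have "((\<lambda>y. \<Sum>i\<in>Basis. blinfun_apply (f' y) i *\<^sub>R i) has_derivative
      (\<lambda>h. \<Sum>i\<in>Basis. blinfun_apply (blinfun_apply (f'' x) h) i *\<^sub>R i)) (at x)"
    by (intro has_derivative_sum has_derivative_scaleR_left
        bounded_linear.has_derivative[OF blinfun.bounded_linear_left] *(2))
  then show thesis using that F by simp
qed

text \<open>
A \<open>C2\<close> energy has a differentiable gradient, but for \<open>a \<noteq> b\<close> the gradient has a kink at the singular
matrix $0$. For \<open>a = b\<close> the energy is quadratic.
\<close>

lemma energy_C2_iff:
  fixes lam mu a b :: real
  assumes lam: "0 \<le> lam" and mu: "0 < mu" and ab: "0 \<le> a" "0 \<le> b"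
  defines "f \<equiv> \<lambda>E :: 'n::finite symmat. a * psi0_plus lam mu E + b * psi0_plus lam mu (- E)"
  shows "C2_on UNIV f \<longleftrightarrow> a = b"
proof
  have f: "GDERIV f E :> stress lam mu a b E" for E
    unfolding f_def using lam mu ab by (intro GDERIV_energy) auto
  show "a = b" if C2: "C2_on UNIV f"
  proof (rule ccontr)
    assume "a \<noteq> b"
    obtain D where "(stress lam mu a b has_derivative D) (at (0 :: 'n symmat))"
      using gradient_differentiable_if_C2[OF C2 f] by blast
    then obtain D' where "(stress_plus lam mu has_derivative D') (at (0 :: 'n symmat))"
      using stress_plus_has_derivative_from_stress[OF \<open>a \<noteq> b\<close>] by blast
    then have "axis i 1 = (0 :: real^'n)" for i
      using stress_plus_differentiable_imp_invertible[OF lam mu] by (metis act_simps(10))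
    then show False by (simp add: axis_eq_0_iff)
  qed
  show "C2_on UNIV f" if "a = b"
  proof -
    have st: "stress lam mu a b E = b *\<^sub>R elastic_stress lam mu E" for E
      using that by (simp add: stress_eq)
    define F where "F E = blinfun_inner_left (b *\<^sub>R elastic_stress lam mu E)" for E :: "'n symmat"
    have lin: "bounded_linear F" unfolding F_def
      by (intro bounded_linear_compose[OF bounded_linear_blinfun_inner_left]
          bounded_linear_compose[OF bounded_linear_scaleR_right] bounded_linear_elastic_stress)
    have "(F has_derivative blinfun_apply (Blinfun F)) (at E)" for E
      using lin by (simp add: bounded_linear_Blinfun_apply bounded_linear_imp_has_derivative)
    moreover have "(f has_derivative blinfun_apply (F E)) (at E)" for E
      using f[of E] unfolding GDERIV_blinfun st F_def .
    ultimately show ?thesis unfolding C2_on_def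
      by (intro exI[of _ F] exI[of _ "\<lambda>_. Blinfun F"]) auto
  qed
qed

theorem lemma2p9:
  fixes lam mu k :: real and g :: "real \<Rightarrow> real"
    and \<psi> :: "'n::finite symmat \<Rightarrow> real \<Rightarrow> real"
  defines "\<psi> \<equiv> psi lam mu k g"
  assumes "lam \<ge> 0" and "mu > 0" and "k > 0"
    and "g ` {0..1} \<subseteq> {0..1}" and "convex_on {0..1} g" and "C2_on {0..1} g"
    and "antimono_on {0..1} g" and "g 0 = 1" and "g 1 = 0"
  shows
    "((\<forall>E. C2_on {0..1} (\<lambda>d. \<psi> E d)) \<and> (\<forall>d\<in>{0..1}. C11 (\<lambda>E. \<psi> E d)))
   \<and> (\<forall>d\<in>{0..1}. semismooth (gradient (\<lambda>E. \<psi> E d)))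
   \<and> (\<exists>L\<ge>0. \<forall>d\<in>{0..1}. \<forall>A B.
        norm (gradient (\<lambda>E. \<psi> E d) A - gradient (\<lambda>E. \<psi> E d) B) \<le> L * norm (A - B))
   \<and> (\<exists>\<eta>>0. \<forall>d\<in>{0..1}. \<forall>A B. \<forall>t\<in>{0..1}.
        \<psi> (t *\<^sub>R A + (1 - t) *\<^sub>R B) d
          \<le> t * \<psi> A d + (1 - t) * \<psi> B d - 1/2 * \<eta> * t * (1 - t) * (norm (A - B))\<^sup>2)
   \<and> (\<exists>C>0. \<forall>d\<in>{0..1}. \<forall>E. \<psi> E d \<ge> C * (norm E)\<^sup>2)
   \<and> (\<forall>d\<in>{0..1}. C2_on UNIV (\<lambda>E. \<psi> E d) \<longleftrightarrow> g d = 1)"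
proof -
  have lam: "0 \<le> lam" and mu: "0 < mu" "0 \<le> mu" and k: "0 < k" using assms by auto
  have ab: "0 \<le> g d + k" "k \<le> g d + k" "g d + k \<le> 1 + k" "0 \<le> 1 + k" if "d \<in> {0..1}" for d
    using assms(5) k that by (auto simp: image_subset_iff)
  have \<psi>: "\<psi> E d = (g d + k) * psi0_plus lam mu E + (1 + k) * psi0_plus lam mu (- E)" for E d
    unfolding \<psi>_def by (rule psi_eq)
  have G: "GDERIV (\<lambda>E. \<psi> E d) E :> stress lam mu (g d + k) (1 + k) E" if "d \<in> {0..1}" for d E
    unfolding \<psi> using ab[OF that] by (intro GDERIV_energy lam mu)
  have grad: "gradient (\<lambda>E. \<psi> E d) = stress lam mu (g d + k) (1 + k)" if "d \<in> {0..1}" for d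
    using gradient_eqI[OF G[OF that]] by (rule ext)
  define c where "c = stress_bound TYPE('n) lam mu"
  have c: "0 \<le> c" using lam mu by (simp add: c_def stress_bound_def)
  have Lip: "norm (stress lam mu (g d + k) (1 + k) A - stress lam mu (g d + k) (1 + k) B)
      \<le> (2 * (1 + k) * c) * norm (A - B)" if "d \<in> {0..1}" for d and A B :: "'n symmat"
  proof -
    have "(g d + k + (1 + k)) * c * norm (A - B) \<le> (2 * (1 + k) * c) * norm (A - B)"
      using ab[OF that] c by (intro mult_right_mono) auto
    then show ?thesis using stress_Lipschitz[OF lam mu(2) ab(1,4)[OF that], of A B] by (simp add: c_def)
  qed
  show ?thesis
  proof (intro conjI ballI allI)
    show "C2_on {0..1} (\<lambda>d. \<psi> E d)" for E
      unfolding \<psi> by (intro C2_on_affine assms)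
    show "C11 (\<lambda>E. \<psi> E d)" if "d \<in> {0..1}" for d
      by (rule C11_if_gradient_Lipschitz[OF G[OF that] Lip[OF that]])
    show "semismooth (gradient (\<lambda>E. \<psi> E d))" if "d \<in> {0..1}" for d
      unfolding grad[OF that] using ab[OF that] by (intro semismooth_stress lam mu)
    show "\<exists>L\<ge>0. \<forall>d\<in>{0..1}. \<forall>A B.
        norm (gradient (\<lambda>E. \<psi> E d) A - gradient (\<lambda>E. \<psi> E d) B) \<le> L * norm (A - B)"
      using Lip grad c k by (intro exI[of _ "2 * (1 + k) * c"]) auto
    show "\<exists>\<eta>>0. \<forall>d\<in>{0..1}. \<forall>A B. \<forall>t\<in>{0..1}.
        \<psi> (t *\<^sub>R A + (1 - t) *\<^sub>R B) d
          \<le> t * \<psi> A d + (1 - t) * \<psi> B d - 1/2 * \<eta> * t * (1 - t) * (norm (A - B))\<^sup>2"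
    proof (intro exI[of _ "2 * (k * mu)"] conjI ballI allI)
      fix d t :: real and A B :: "'n symmat" assume "d \<in> {0..1}" "t \<in> {0..1}"
      then have "\<psi> (t *\<^sub>R A + (1 - t) *\<^sub>R B) d
          \<le> t * \<psi> A d + (1 - t) * \<psi> B d - k * mu * (t * (1 - t) * (norm (A - B))\<^sup>2)"
        unfolding \<psi> using k ab[of d] by (intro energy_strongly_convex lam mu) auto
      then show "\<psi> (t *\<^sub>R A + (1 - t) *\<^sub>R B) d
          \<le> t * \<psi> A d + (1 - t) * \<psi> B d - 1/2 * (2 * (k * mu)) * t * (1 - t) * (norm (A - B))\<^sup>2"
        by (simp add: mult_ac)
    qed (use k mu in simp)
    show "\<exists>C>0. \<forall>d\<in>{0..1}. \<forall>E. \<psi> E d \<ge> C * (norm E)\<^sup>2"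
      using k mu energy_coercive[OF lam mu(2) less_imp_le[OF k] ab(2,3), where ?'a = 'n]
      unfolding \<psi> by (intro exI[of _ "k * mu"]) simp
    show "C2_on UNIV (\<lambda>E. \<psi> E d) \<longleftrightarrow> g d = 1" if "d \<in> {0..1}" for d
      unfolding \<psi> using energy_C2_iff[OF lam mu(1) ab(1,4)[OF that]] by simp
  qed
qed

end
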